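(* There exist an infinite set $\mathfrak C\subseteq(0,1)$ and a set $E\subset[0,1]$ with $\dim_{\mathbb F}E=1$ such that $E$ contains no nontrivial solution of $$tx+(1-t)y=z\quad\text{for any } t\in\mathfrak C;$$ that is, for no $t\in\mathfrak C$ do there exist pairwise distinct $x,y,z\in E$ with $tx+(1-t)y=z$. The set $\mathfrak C$ contains infinitely many rationals and uncountably many irrationals.
   Context: A solution $(x,y,z)$ of the equation is nontrivial if its entries are all distinct. The Fourier transform of a measure $\mu$ is $\widehat\mu(\xi)=\int e^{-ix\xi}\,d\mu(x)$. The Fourier dimension $\dim_{\mathbb F}(A)$ of a Borel set $A\subseteq\mathbb R$ is the supremum of exponents $\beta\le 1$ for which there exist a probability measure $\mu$ supported on $A$ and a finite constant $C_2>0$ with $|\widehat\mu(\xi)|\le C_2(1+|\xi|)^{-\beta/2}$ for all $\xi\in\mathbb R$. *)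

theory Defs
  imports "HOL-Probability.Probability"
begin

definition fourier_transform :: "real measure \<Rightarrow> real \<Rightarrow> complex" where
  "fourier_transform \<mu> \<xi> = (CLINT x|\<mu>. exp (- (\<i> * of_real x * of_real \<xi>)))"

text \<open>The library's characteristic function uses the opposite sign in the exponent.\<close>

lemma fourier_transform_eq_char: "fourier_transform \<mu> \<xi> = char \<mu> (- \<xi>)"
  by (simp add: fourier_transform_def char_def mult_ac)

text \<open>A probability measure is supported on a Borel set \<open>A\<close> if it gives \<open>A\<close> full measure; its
  topological support may be larger than \<open>A\<close> when \<open>A\<close> is not closed.\<close>

definition supported_prob_measure :: "real set \<Rightarrow> real measure \<Rightarrow> bool" where
  "supported_prob_measure A \<mu> \<longleftrightarrow>
     prob_space \<mu> \<and> sets \<mu> = sets borel \<and> emeasure \<mu> A = 1"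

text \<open>Meant for Borel sets only. The supremum is taken in the extended reals so that the empty set,
  which carries no probability measure, gets the value \<open>-\<infinity>\<close> instead of an
  unspecified real number. For nonempty \<open>A\<close> every \<open>\<beta> \<le> 0\<close> is admissible (take a point
  mass), so the value lies in \<open>{0..1}\<close>.\<close>

definition fourier_dim :: "real set \<Rightarrow> ereal" where
  "fourier_dim A = Sup {ereal \<beta> | \<beta>. \<beta> \<le> 1 \<and>
     (\<exists>\<mu> C. supported_prob_measure A \<mu> \<and> C > 0 \<and>
        (\<forall>\<xi>::real. cmod (fourier_transform \<mu> \<xi>) \<le> C * (1 + \<bar>\<xi>\<bar>) powr (- \<beta> / 2)))}"

definition nontrivial_solution :: "real \<Rightarrow> real \<Rightarrow> real \<Rightarrow> real \<Rightarrow> bool" where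
  "nontrivial_solution t x y z \<longleftrightarrow>
     t * x + (1 - t) * y = z \<and> x \<noteq> y \<and> y \<noteq> z \<and> x \<noteq> z"

end

theory Submission
  imports Defs
begin

text \<open>
  The set \<open>E\<close> is a random Cantor set in mixed radix. Inside each surviving interval of level \<open>k\<close>,
  the admissible next digits form a cyclic shift of a Behrend-type set of \<open>m k \<ge> N k powr (1 - o(1))\<close>
  digits out of \<open>N k\<close>, which has no approximate solutions modulo \<open>N k\<close> of \<open>p a + (M - p) b = M c\<close>,
  \<open>0 < p < M\<close>. If \<open>t\<close> is within \<open>1 / N k\<close> of such a fraction \<open>p / M\<close> for every level \<open>k\<close>, three points
  of \<open>E\<close> with \<open>t x + (1 - t) y = z\<close> lie in a common interval of every level and so coincide. The
  sequence \<open>M i\<close> may grow so fast that the \<open>t\<close> with this property include \<open>1/4 + (\<Sum>i\<in>S. 1 / M (i + 1))\<close>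
  for all sets \<open>S\<close> of natural numbers; each \<open>M i\<close> serves many consecutive levels, so that \<open>N k\<close> stays
  at most linear in \<open>k\<close>.

  Independent shifts of the intervals would change the Fourier transform from one level to the next by
  roughly the inverse square root of the number of intervals, by Chernoff bounds. The shifts are chosen
  one after the other so as not to increase the exponential moment behind these bounds. This gives
  decay of order \<open>\<beta> / 2\<close> for every \<open>\<beta> < 1\<close>, for one and the same measure.
\<close>


section \<open>Digit sets without solutions\<close>

lemma base_expansion_less:
  fixes u :: "nat \<Rightarrow> nat"
  assumes "\<And>i. i < n \<Longrightarrow> u i < b"
  shows "(\<Sum>i<n. u i * b ^ i) < b ^ n"
  using assms
proof (induction n)
  case (Suc n)
  have "(\<Sum>i<n. u i * b ^ i) < b ^ n" using Suc by simp
  moreover have "u n * b ^ n + b ^ n \<le> b * b ^ n"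
    using Suc.prems[of n] mult_le_mono1[of "Suc (u n)" b "b ^ n"] by simp
  ultimately show ?case by simp
qed simp

lemma base_expansion_unique:
  fixes u w :: "nat \<Rightarrow> nat"
  assumes "\<And>i. i < n \<Longrightarrow> u i < b" "\<And>i. i < n \<Longrightarrow> w i < b"
    and "(\<Sum>i<n. u i * b ^ i) = (\<Sum>i<n. w i * b ^ i)" "j < n"
  shows "u j = w j"
  using assms
proof (induction n arbitrary: u w j)
  case (Suc n)
  have b: "0 < b" using Suc.prems(1)[of 0] by simp
  have split: "(\<Sum>i<Suc n. v i * b ^ i) = v 0 + b * (\<Sum>i<n. v (Suc i) * b ^ i)" for v :: "nat \<Rightarrow> nat"
    by (simp add: sum.lessThan_Suc_shift sum_distrib_left mult_ac del: sum.lessThan_Suc)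
  have eq: "u 0 + b * (\<Sum>i<n. u (Suc i) * b ^ i) = w 0 + b * (\<Sum>i<n. w (Suc i) * b ^ i)"
    using Suc.prems(3) by (simp only: split)
  have lt: "u 0 < b" "w 0 < b" using Suc.prems(1,2) by auto
  have 0: "u 0 = w 0"
    using arg_cong[OF eq, of "\<lambda>x. x mod b"] lt by simp
  then have "(\<Sum>i<n. u (Suc i) * b ^ i) = (\<Sum>i<n. w (Suc i) * b ^ i)"
    using eq b by simp
  then have "u (Suc i) = w (Suc i)" if "i < n" for i
    using Suc.IH[of "\<lambda>i. u (Suc i)" "\<lambda>i. w (Suc i)" i] Suc.prems that by auto
  with 0 show ?case using Suc.prems(4) by (cases j) auto
qed simp

text \<open>Vectors with digits below \<open>d\<close> and equal sum of squares lie on a sphere,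
  where no point is a proper weighted mean of two distinct points. There are only
  \<open>n * d\<^sup>2\<close> possible sums of squares, so some sphere is large by the pigeonhole
  principle. Base \<open>M * d\<close> leaves room for the weights: no carries occur, and the
  equation holds digit by digit.\<close>

lemma behrend:
  fixes M d n :: nat
  assumes "0 < M" "0 < d" "0 < n"
  obtains B :: "nat set" where "B \<subseteq> {..<(M * d) ^ n}" "d ^ n \<le> card B * (n * d\<^sup>2)"
    "\<And>p a b c. \<lbrakk>0 < p; p < M; a \<in> B; b \<in> B; c \<in> B; p * a + (M - p) * b = M * c\<rbrakk> \<Longrightarrow> a = b \<and> b = c"
proof -
  define V :: "(nat \<Rightarrow> nat) set" where "V = PiE {..<n} (\<lambda>_. {..<d})"
  define sq where "sq v = (\<Sum>i<n. (v i)\<^sup>2)" for v :: "nat \<Rightarrow> nat"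
  define enc where "enc v = (\<Sum>i<n. v i * (M * d) ^ i)" for v :: "nat \<Rightarrow> nat"
  have V: "finite V" "card V = d ^ n" by (auto simp: V_def card_PiE intro!: finite_PiE)
  have digit: "v i < d" if "v \<in> V" "i < n" for v i
    using that by (auto simp: V_def PiE_iff)
  have "sq v < n * d\<^sup>2" if "v \<in> V" for v
  proof -
    have "sq v < (\<Sum>i<n. d\<^sup>2)"
      unfolding sq_def using digit[OF that] assms
      by (intro sum_strict_mono) (auto intro!: power_strict_mono)
    then show ?thesis by simp
  qed
  then have "sq \<in> V \<rightarrow> {..<n * d\<^sup>2}" by auto
  then obtain R where R: "card V \<le> card (sq -` {R} \<inter> V) * card {..<n * d\<^sup>2}"
    using pigeonhole_card[of sq V "{..<n * d\<^sup>2}"] V assms by (auto simp: lessThan_empty_iff)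
  define W where "W = sq -` {R} \<inter> V"
  have WV: "W \<subseteq> V" by (auto simp: W_def)
  have encless: "v i < M * d" if "v \<in> V" "i < n" for v i
  proof -
    have "v i * 1 < d * M" using digit[OF that] assms by (intro mult_less_le_imp_less) auto
    then show ?thesis by (simp add: mult.commute)
  qed
  have key: "(\<forall>i<n. x i = y i) \<and> (\<forall>i<n. y i = z i)"
    if p: "0 < p" "p < M" and xyz: "x \<in> W" "y \<in> W" "z \<in> W"
      and eq: "p * enc x + (M - p) * enc y = M * enc z" for p x y z
  proof -
    have dig: "p * x i + (M - p) * y i = M * z i" if "i < n" for i
    proof -
      have eq': "(\<Sum>i<n. (p * x i + (M - p) * y i) * (M * d) ^ i) = (\<Sum>i<n. (M * z i) * (M * d) ^ i)"
        using eq by (simp add: enc_def sum_distrib_left sum.distrib algebra_simps)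
      have 1: "p * x i + (M - p) * y i < M * d" if "i < n" for i
      proof -
        have "p * x i < p * d" "(M - p) * y i < (M - p) * d"
          using digit WV xyz p that by auto
        moreover have "p * d + (M - p) * d = M * d" using p by (simp flip: add_mult_distrib)
        ultimately show ?thesis by linarith
      qed
      have 2: "M * z i < M * d" if "i < n" for i
        using digit WV xyz p that by auto
      show ?thesis by (rule base_expansion_unique[OF 1 2 eq' that])
    qed
    have rdig: "real p * x i + (real M - p) * y i = real M * z i" if "i < n" for i
      using arg_cong[OF dig[OF that], of real] p by (simp add: of_nat_diff)
    have rsq: "(\<Sum>i<n. (real (v i))\<^sup>2) = R" if "v \<in> W" for v
      using that by (auto simp: W_def sq_def)
    \<comment> \<open>Strict convexity as an identity, using \<open>M z = p x + (M - p) y\<close> in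
      each coordinate. The right side vanishes after summation because the three vectors have the
      same sum of squares \<open>R\<close>.\<close>
    have "real p * (real M - p) * (\<Sum>i<n. (real (x i) - y i)\<^sup>2)
        = (\<Sum>i<n. real M * (real p * (real (x i))\<^sup>2 + (real M - p) * (real (y i))\<^sup>2)
             - (real M * z i)\<^sup>2)"
      unfolding sum_distrib_left
    proof (intro sum.cong refl)
      fix i assume "i \<in> {..<n}"
      then show "real p * (real M - p) * (real (x i) - y i)\<^sup>2 =
          real M * (real p * (real (x i))\<^sup>2 + (real M - p) * (real (y i))\<^sup>2) - (real M * z i)\<^sup>2"
        by (simp flip: rdig) (simp add: power2_eq_square algebra_simps)
    qed
    also have "\<dots> = real M * (real p * (\<Sum>i<n. (real (x i))\<^sup>2) + (real M - p) * (\<Sum>i<n. (real (y i))\<^sup>2))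
        - (real M)\<^sup>2 * (\<Sum>i<n. (real (z i))\<^sup>2)"
      by (simp add: sum_subtractf sum.distrib sum_distrib_left power_mult_distrib algebra_simps)
    also have "\<dots> = 0" using rsq xyz by (simp add: algebra_simps power2_eq_square)
    finally have "(\<Sum>i<n. (real (x i) - y i)\<^sup>2) = 0" using p by simp
    then have xy: "\<forall>i<n. x i = y i" by (subst (asm) sum_nonneg_eq_0_iff) auto
    moreover have "y i = z i" if "i < n" for i
      using dig[OF that] xy that p by (auto simp flip: add_mult_distrib)
    ultimately show ?thesis by auto
  qed
  have ext: "x = y" if "x \<in> W" "y \<in> W" "\<forall>i<n. x i = y i" for x y
    using that WV by (auto simp: V_def intro!: PiE_ext[of x "{..<n}" _ y])
  have inj: "inj_on enc W"
  proof (rule inj_onI)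
    fix x y assume xy: "x \<in> W" "y \<in> W" "enc x = enc y"
    have "\<forall>i<n. x i = y i"
      using base_expansion_unique[of n x "M * d" y] xy encless WV by (auto simp: enc_def)
    then show "x = y" using ext xy by blast
  qed
  show thesis
  proof (rule that[of "enc ` W"])
    show "enc ` W \<subseteq> {..<(M * d) ^ n}"
      using base_expansion_less encless WV by (auto simp: enc_def)
    show "d ^ n \<le> card (enc ` W) * (n * d\<^sup>2)"
      using R V inj by (simp add: card_image W_def)
    show "a = b \<and> b = c" if "0 < p" "p < M" "a \<in> enc ` W" "b \<in> enc ` W" "c \<in> enc ` W"
      "p * a + (M - p) * b = M * c" for p a b c
    proof -
      from that obtain x y z where xyz: "x \<in> W" "y \<in> W" "z \<in> W" "a = enc x" "b = enc y" "c = enc z"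
        by blast
      then have "x = y" "y = z" using key[of p x y z] ext that by blast+
      then show ?thesis using xyz by simp
    qed
  qed
qed

text \<open>The modulus \<open>N\<close> accounts for cyclic shifts of the digits. The error \<open>2 * M\<close> absorbs both the digits of
  higher levels and the replacement of a real coefficient \<open>t\<close> by the fraction \<open>p / M\<close>.\<close>

definition avoiding_digits :: "nat \<Rightarrow> nat \<Rightarrow> nat set \<Rightarrow> bool" where
  "avoiding_digits M N A \<longleftrightarrow> (\<forall>p a b c (w::int). 0 < p \<longrightarrow> p < M \<longrightarrow> a \<in> A \<longrightarrow> b \<in> A \<longrightarrow> c \<in> A \<longrightarrow>
     \<bar>int p * int a + (int M - int p) * int b - int M * int c + int N * w\<bar> < 2 * int M \<longrightarrow> a = b \<and> b = c)"

text \<open>All digits and \<open>N\<close> are multiples of \<open>2 * M\<close>, hence so is the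
  whole expression, and an absolute value below \<open>2 * M\<close> forces it to be 0. The
  remaining factor \<open>K\<close> of \<open>N\<close> exceeds every value of the expression on
  \<open>B\<close>, which excludes wrapping around.\<close>

lemma dense_avoiding_digits:
  fixes M r :: nat
  assumes M: "0 < M" and r: "0 < r"
  obtains N A where "2 \<le> N" "A \<subseteq> {..<N}" "avoiding_digits M N A" "N ^ (r - 1) \<le> card A ^ r"
proof -
  \<comment> \<open>In the exponent count \<open>1 + n * (r - 1) + 2 * r \<le> n * r\<close> at the
    end, \<open>2 * r\<close> pays for the loss of \<open>D\<^sup>2\<close> in
    \<open>behrend\<close>, and the single factor \<open>D\<close> is exactly the product of the
    constants.\<close>
  define n where "n = 3 * r"
  define D where "D = n ^ r * (2 * M ^ (n + 2)) ^ (r - 1)"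
  have pos: "0 < n" "0 < D" using M r by (auto simp: D_def n_def)
  obtain B where B: "B \<subseteq> {..<(M * D) ^ n}" "D ^ n \<le> card B * (n * D\<^sup>2)"
    and Bavoid: "\<And>p a b c. \<lbrakk>0 < p; p < M; a \<in> B; b \<in> B; c \<in> B; p * a + (M - p) * b = M * c\<rbrakk> \<Longrightarrow> a = b \<and> b = c"
    using behrend[OF M pos(2,1)] by metis
  define K where "K = M * (M * D) ^ n"
  define N where "N = 2 * M * K"
  define A where "A = (\<lambda>b. 2 * M * b) ` B"
  have cardA: "card A = card B"
    unfolding A_def by (rule card_image) (use M in \<open>auto simp: inj_on_def\<close>)
  have K: "0 < K" using M pos by (simp add: K_def)
  show thesis
  proof (rule that[of N A])
    show "2 \<le> N" using M K by (simp add: N_def Suc_leI)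
    have "(M * D) ^ n \<le> K" using M by (simp add: K_def)
    then show "A \<subseteq> {..<N}" using B(1) M by (force simp: A_def N_def)
    show "avoiding_digits M N A"
      unfolding avoiding_digits_def
    proof (intro allI impI)
      fix p a b c w
      assume p: "0 < p" "p < M" and "a \<in> A" "b \<in> A" "c \<in> A"
        and *: "\<bar>int p * int a + (int M - int p) * int b - int M * int c + int N * w\<bar> < 2 * int M"
      then obtain a' b' c' where abc: "a' \<in> B" "b' \<in> B" "c' \<in> B" "a = 2 * M * a'" "b = 2 * M * b'" "c = 2 * M * c'"
        by (auto simp: A_def)
      define W where "W = int p * int a' + (int M - int p) * int b' - int M * int c'"
      have "int p * int a + (int M - int p) * int b - int M * int c + int N * w = 2 * int M * (W + int K * w)"
        by (simp add: abc W_def N_def algebra_simps)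
      then have "2 * int M * \<bar>W + int K * w\<bar> < 2 * int M * 1" using * M by (simp add: abs_mult)
      then have W0: "W + int K * w = 0" using M by (subst (asm) mult_less_cancel_left) auto
      have lt: "int a' < int ((M * D) ^ n)" "int b' < int ((M * D) ^ n)" "int c' < int ((M * D) ^ n)"
        using B(1) abc by (auto simp del: of_nat_mult of_nat_power)
      define L where "L = int ((M * D) ^ n)"
      have split: "int M * L = int p * L + (int M - int p) * L" by (simp add: algebra_simps)
      have 1: "int p * int a' < int p * L" and 2: "(int M - int p) * int b' < (int M - int p) * L"
        and 3: "int M * int c' < int M * L"
        using lt p M unfolding L_def by (intro mult_strict_left_mono; simp)+
      have 4: "0 \<le> int p * int a'" "0 \<le> (int M - int p) * int b'" "0 \<le> int M * int c'"
        using p by auto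
      have "\<bar>W\<bar> < int M * L" unfolding W_def using split 1 2 3 4 by linarith
      also have "int M * L = int K" by (simp add: K_def L_def)
      finally have "\<bar>W\<bar> < int K" .
      moreover have "W = int K * (- w)" using W0 by simp
      ultimately have "int K * \<bar>w\<bar> < int K * 1" by (simp add: abs_mult)
      then have "\<bar>w\<bar> < 1" using K by (subst (asm) mult_less_cancel_left) auto
      then have "W = 0" using W0 by simp
      then have "int (p * a' + (M - p) * b') = int (M * c')"
        using p unfolding W_def by (simp add: of_nat_diff)
      then have "p * a' + (M - p) * b' = M * c'" by (simp only: of_nat_eq_iff)
      then show "a = b \<and> b = c" using Bavoid[OF p abc(1-3)] abc by simp
    qed
    have "N = 2 * M ^ (n + 2) * D ^ n" by (simp add: N_def K_def power_mult_distrib power_add power2_eq_square)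
    then have "N ^ (r - 1) * (n ^ r * D ^ (2 * r)) = D * D ^ (n * (r - 1)) * D ^ (2 * r)"
      by (simp add: power_mult_distrib D_def power_mult mult_ac)
    also have "\<dots> = D ^ (1 + n * (r - 1) + 2 * r)" by (simp add: power_add)
    also have "\<dots> \<le> D ^ (n * r)"
    proof (rule power_increasing)
      have "n * r = n * (r - 1) + n" using r by (cases r) auto
      then show "1 + n * (r - 1) + 2 * r \<le> n * r" using r by (simp add: n_def)
    qed (use pos in simp)
    also have "\<dots> = (D ^ n) ^ r" by (simp add: power_mult)
    also have "\<dots> \<le> (card B * (n * D\<^sup>2)) ^ r" by (rule power_mono[OF B(2)]) simp
    also have "\<dots> = card A ^ r * (n ^ r * D ^ (2 * r))"
      by (simp add: cardA power_mult_distrib power_mult)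
    finally show "N ^ (r - 1) \<le> card A ^ r" using pos by simp
  qed
qed

section \<open>Choosing the shifts\<close>

text \<open>Serves to bound the exponential moment of a centred variable: the linear term averages
  out and only \<open>exp (y\<^sup>2)\<close> remains.\<close>

lemma exp_le_add_exp_square: "exp y \<le> y + exp (y\<^sup>2)" for y :: real
proof -
  have ge: "1 + y\<^sup>2 \<le> exp (y\<^sup>2)" by (rule exp_ge_add_one_self)
  consider "1 \<le> y" | "0 \<le> y" "y \<le> 1" | "-1 \<le> y" "y \<le> 0" | "y \<le> -1" by linarith
  then show ?thesis
  proof cases
    case 1
    then have "y \<le> y\<^sup>2" by (simp add: power2_eq_square)
    then have "exp y \<le> exp (y\<^sup>2)" by simp
    then show ?thesis using 1 by linarith
  next
    case 2
    have "exp y \<le> y + (1 + y\<^sup>2)" using exp_bound[OF 2] by simp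
    also have "\<dots> \<le> y + exp (y\<^sup>2)" using ge by (rule add_left_mono)
    finally show ?thesis .
  next
    case 3
    define u where "u = - y"
    have u: "0 \<le> u" using 3 by (simp add: u_def)
    \<comment> \<open>The first factor is the bound sought for \<open>exp (- u)\<close>, the second
      is the quadratic Taylor polynomial of \<open>exp u\<close>.\<close>
    have "1 * 1 \<le> (1 - u + u\<^sup>2) * (1 + u + u\<^sup>2 / 2)"
    proof -
      have "(1 - u + u\<^sup>2) * (1 + u + u\<^sup>2 / 2) = 1 + (u\<^sup>2 / 2 + u ^ 3 / 2 + u ^ 4 / 2)"
        by (simp add: field_simps power2_eq_square power3_eq_cube power4_eq_xxxx)
      then show ?thesis using u by simp
    qed
    also have "\<dots> \<le> (1 - u + u\<^sup>2) * exp u"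
    proof (rule mult_left_mono)
      show "1 + u + u\<^sup>2 / 2 \<le> exp u" using u by (rule exp_lower_Taylor_quadratic)
      have "0 \<le> (u - 1/2)\<^sup>2" by simp
      then show "0 \<le> 1 - u + u\<^sup>2" by (simp add: power2_eq_square algebra_simps)
    qed
    finally have "exp (- u) \<le> 1 - u + u\<^sup>2" by (simp add: exp_minus field_simps)
    then have "exp y \<le> y + (1 + y\<^sup>2)" by (simp add: u_def)
    also have "\<dots> \<le> y + exp (y\<^sup>2)" using ge by (rule add_left_mono)
    finally show ?thesis .
  next
    case 4
    have "0 \<le> y * (y + 1)" using 4 by (intro mult_nonpos_nonpos) auto
    then have "1 \<le> y + (1 + y\<^sup>2)" by (simp add: power2_eq_square algebra_simps)
    moreover have "exp y \<le> 1" using 4 by simp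
    ultimately have "exp y \<le> y + (1 + y\<^sup>2)" by (rule order.trans[rotated])
    also have "\<dots> \<le> y + exp (y\<^sup>2)" using ge by (rule add_left_mono)
    finally show ?thesis .
  qed
qed

text \<open>The method of conditional expectations: averaging over the \<open>N\<close> options for
  \<open>s P\<close> multiplies each weight \<open>w g\<close> by at most
  \<open>exp (l\<^sup>2)\<close>, so a single option achieves this for the whole sum over
  \<open>G\<close>.\<close>

lemma exp_moment_choice:
  fixes X :: "'g \<Rightarrow> nat \<Rightarrow> nat \<Rightarrow> real" and l :: real
  assumes N: "0 < N"
    and bounded: "\<And>g c i. g \<in> G \<Longrightarrow> i < N \<Longrightarrow> \<bar>X g c i\<bar> \<le> 1"
    and centred: "\<And>g c. g \<in> G \<Longrightarrow> (\<Sum>i<N. X g c i) = 0"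
  shows "\<exists>s. (\<forall>c. s c < N) \<and>
    (\<Sum>g\<in>G. exp (l * (\<Sum>c<P. X g c (s c)))) \<le> real (card G) * exp (l\<^sup>2 * real P)"
proof (induction P)
  case 0
  show ?case using N by (intro exI[of _ "\<lambda>_. 0"]) simp
next
  case (Suc P)
  then obtain s where s: "\<forall>c. s c < N"
    and IH: "(\<Sum>g\<in>G. exp (l * (\<Sum>c<P. X g c (s c)))) \<le> real (card G) * exp (l\<^sup>2 * real P)" by blast
  define w where "w g = exp (l * (\<Sum>c<P. X g c (s c)))" for g
  define \<Psi> where "\<Psi> i = (\<Sum>g\<in>G. w g * exp (l * X g P i))" for i
  have avg: "(\<Sum>i<N. exp (l * X g P i)) \<le> real N * exp (l\<^sup>2)" if g: "g \<in> G" for g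
  proof -
    have "(\<Sum>i<N. exp (l * X g P i)) \<le> (\<Sum>i<N. l * X g P i + exp (l\<^sup>2))"
    proof (rule sum_mono)
      fix i assume "i \<in> {..<N}"
      then have "\<bar>X g P i\<bar> \<le> 1" using bounded g by simp
      then have "(X g P i)\<^sup>2 \<le> 1" by (simp add: abs_square_le_1)
      then have "(l * X g P i)\<^sup>2 \<le> l\<^sup>2" by (simp add: power_mult_distrib mult_left_le)
      then show "exp (l * X g P i) \<le> l * X g P i + exp (l\<^sup>2)"
        using exp_le_add_exp_square[of "l * X g P i"] by (smt (verit) exp_le_cancel_iff)
    qed
    also have "\<dots> = real N * exp (l\<^sup>2)"
      using centred[OF g] by (simp add: sum.distrib flip: sum_distrib_left)
    finally show ?thesis .
  qed
  have "(\<Sum>i<N. \<Psi> i) = (\<Sum>g\<in>G. w g * (\<Sum>i<N. exp (l * X g P i)))"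
    unfolding \<Psi>_def sum_distrib_left by (rule sum.swap)
  also have "\<dots> \<le> (\<Sum>g\<in>G. w g * (real N * exp (l\<^sup>2)))"
    using avg by (intro sum_mono mult_left_mono) (auto simp: w_def)
  also have "\<dots> = (\<Sum>i<N. (\<Sum>g\<in>G. w g) * exp (l\<^sup>2))"
    by (simp add: sum_distrib_right sum_distrib_left mult_ac)
  finally have "\<exists>i<N. \<Psi> i \<le> (\<Sum>g\<in>G. w g) * exp (l\<^sup>2)"
    using N sum_strict_mono[of "{..<N}" "\<lambda>_. (\<Sum>g\<in>G. w g) * exp (l\<^sup>2)" \<Psi>]
    by (force simp: not_le)
  then obtain i where i: "i < N" "\<Psi> i \<le> (\<Sum>g\<in>G. w g) * exp (l\<^sup>2)" by blast
  show ?case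
  proof (intro exI[of _ "s(P := i)"] conjI)
    have "(\<Sum>g\<in>G. exp (l * (\<Sum>c<Suc P. X g c ((s(P := i)) c)))) = \<Psi> i"
      by (simp add: \<Psi>_def w_def exp_add distrib_left)
    also have "\<dots> \<le> (real (card G) * exp (l\<^sup>2 * real P)) * exp (l\<^sup>2)"
      using i(2) IH unfolding w_def by (smt (verit) exp_gt_zero mult_right_mono)
    also have "\<dots> = real (card G) * exp (l\<^sup>2 * real (Suc P))"
      by (simp add: exp_add algebra_simps)
    finally show "(\<Sum>g\<in>G. exp (l * (\<Sum>c<Suc P. X g c ((s(P := i)) c))))
      \<le> real (card G) * exp (l\<^sup>2 * real (Suc P))" .
  qed (use s i in auto)
qed

text \<open>A Chernoff bound: each term of the exponential moment is at most the whole sum, and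
  \<open>l = sqrt (L / P)\<close> balances the contributions \<open>ln (card G)\<close> and
  \<open>l\<^sup>2 * P\<close>, both at most \<open>L\<close>.\<close>

lemma bounded_sums_choice:
  fixes X :: "'g \<Rightarrow> nat \<Rightarrow> nat \<Rightarrow> real" and L :: real
  assumes N: "0 < N" and P: "0 < P" and G: "finite G" "G \<noteq> {}" and L: "ln (card G) \<le> L" "0 < L"
    and bounded: "\<And>g c i. g \<in> G \<Longrightarrow> i < N \<Longrightarrow> \<bar>X g c i\<bar> \<le> 1"
    and centred: "\<And>g c. g \<in> G \<Longrightarrow> (\<Sum>i<N. X g c i) = 0"
  obtains s where "\<And>c. s c < N" "\<And>g. g \<in> G \<Longrightarrow> (\<Sum>c<P. X g c (s c)) \<le> 2 * sqrt (L * P)"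
proof -
  define l where "l = sqrt (L / P)"
  have l: "0 < l" "l\<^sup>2 * P = L" "l * sqrt (L * P) = L"
    using L P by (auto simp: l_def simp flip: real_sqrt_mult)
  obtain s where s: "\<forall>c. s c < N"
    and le: "(\<Sum>g\<in>G. exp (l * (\<Sum>c<P. X g c (s c)))) \<le> real (card G) * exp (l\<^sup>2 * real P)"
    using exp_moment_choice[of N G X l P, OF N bounded centred] by blast
  show thesis
  proof (rule that[of s])
    fix g assume g: "g \<in> G"
    have "exp (l * (\<Sum>c<P. X g c (s c))) \<le> (\<Sum>g\<in>G. exp (l * (\<Sum>c<P. X g c (s c))))"
      using G g by (intro member_le_sum) auto
    also note le
    also have "real (card G) * exp (l\<^sup>2 * real P) = exp (ln (card G) + L)"
      using G l by (simp add: exp_add card_gt_0_iff)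
    finally have "l * (\<Sum>c<P. X g c (s c)) \<le> 2 * L" using L by simp
    also have "\<dots> = l * (2 * sqrt (L * P))" using l by simp
    finally show "(\<Sum>c<P. X g c (s c)) \<le> 2 * sqrt (L * P)" using l by simp
  qed (use s in auto)
qed

section \<open>Exponential sums over cyclically shifted digits\<close>

lemma sum_shift_mod:
  fixes g :: "nat \<Rightarrow> 'a::comm_monoid_add"
  assumes "0 < N"
  shows "(\<Sum>i<N. g ((a + i) mod N)) = (\<Sum>j<N. g j)"
proof -
  have inj: "inj_on (\<lambda>i. (a + i) mod N) {..<N}"
  proof (rule linorder_inj_onI')
    fix x y assume xy: "x \<in> {..<N}" "y \<in> {..<N}" "x < y"
    then have "\<not> N dvd (a + y) - (a + x)" by (auto dest!: dvd_imp_le)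
    then show "(a + x) mod N \<noteq> (a + y) mod N" using xy mod_eq_dvd_iff_nat[of "a + x" "a + y" N] by auto
  qed
  have "(\<lambda>i. (a + i) mod N) ` {..<N} = {..<N}"
    by (rule endo_inj_surj) (use inj assms in auto)
  then show ?thesis
    using sum.reindex[OF inj, of g] by simp
qed

lemma cmod_cis_diff: "cmod (cis x - cis y) \<le> \<bar>x - y\<bar>"
proof -
  have "cis x - cis y = cis y * (exp (\<i> * (x - y)) - 1)"
    by (simp add: right_diff_distrib cis_mult flip: cis_conv_exp of_real_diff)
  then have "cmod (cis x - cis y) = cmod (exp (\<i> * (x - y)) - 1)" by (simp add: norm_mult)
  also have "\<dots> \<le> \<bar>x - y\<bar>" using iexp_approx1[of "x - y" 0] by (simp)
  finally show ?thesis .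
qed

lemma norm_average_le:
  fixes f :: "nat \<Rightarrow> complex"
  assumes "\<And>i. i < n \<Longrightarrow> cmod (f i) \<le> K" "0 \<le> K"
  shows "cmod ((\<Sum>i<n. f i) / n) \<le> K"
proof (cases "n = 0")
  case False
  have "cmod (\<Sum>i<n. f i) \<le> (\<Sum>i<n. K)"
    using assms by (intro sum_norm_le) auto
  then show ?thesis using False by (simp add: norm_divide field_simps)
qed (use assms in simp)

text \<open>Turns the one-sided real bounds of \<open>bounded_sums_choice\<close> into a bound for
  the modulus.\<close>

lemma cmod_le_of_rotations:
  fixes z :: complex
  assumes "\<And>w. w \<in> {1, -1, \<i>, -\<i>} \<Longrightarrow> Re (w * z) \<le> K"
  shows "cmod z \<le> 2 * K"
  using assms[of 1] assms[of "-1"] assms[of \<i>] assms[of "-\<i>"] cmod_le[of z] by auto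

text \<open>Averaged over all shifts, the sum over the \<open>m\<close> digits becomes the full
  digit sum, so the differences \<open>Y\<close> are centred and \<open>bounded_sums_choice\<close>
  handles finitely many \<open>\<theta>\<close> at once. The multiples of \<open>\<theta>\<close>
  involved are integers below \<open>q\<close>, so the difference is \<open>2 * pi\<close>-periodic
  and Lipschitz in \<open>\<theta>\<close>, and a grid suffices.\<close>

lemma shift_choice:
  fixes J A :: "nat \<Rightarrow> nat" and N P m Q :: nat
  defines "q \<equiv> N * Q"
  assumes P: "0 < P" and m: "0 < m" and N: "2 \<le> N" and Q: "0 < Q"
    and J: "\<And>c. c < P \<Longrightarrow> J c < Q"
  obtains s where "\<And>c. s c < N"
    "\<And>\<theta>. cmod ((\<Sum>c<P. \<Sum>r<m. cis (\<theta> * real (N * J c + (A r + s c) mod N))) / real (P * m)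
       - (\<Sum>c<P. \<Sum>j<N. cis (\<theta> * real (N * J c + j))) / real (P * N))
     \<le> 8 * sqrt (7 * ln q / P) + 2 / q"
proof -
  define Y where "Y \<theta> c i = (\<Sum>r<m. cis (\<theta> * real (N * J c + (A r + i) mod N))) / m
    - (\<Sum>j<N. cis (\<theta> * real (N * J c + j))) / N" for \<theta> :: real and c i :: nat
  define D where "D s \<theta> = (\<Sum>c<P. Y \<theta> c (s c)) / P" for s :: "nat \<Rightarrow> nat" and \<theta> :: real
  have D_eq: "(\<Sum>c<P. \<Sum>r<m. cis (\<theta> * real (N * J c + (A r + s c) mod N))) / real (P * m)
       - (\<Sum>c<P. \<Sum>j<N. cis (\<theta> * real (N * J c + j))) / real (P * N) = D s \<theta>" for s \<theta>
    using P by (simp add: D_def Y_def sum_subtractf diff_divide_distrib mult_ac flip: sum_divide_distrib)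
  have q: "2 \<le> q" using N Q mult_le_mono[of 2 N 1 Q] by (simp add: q_def)
  have centred: "(\<Sum>i<N. Y \<theta> c i) = 0" for \<theta> c
  proof -
    have "(\<Sum>i<N. \<Sum>r<m. cis (\<theta> * real (N * J c + (A r + i) mod N)))
        = (\<Sum>r<m. \<Sum>j<N. cis (\<theta> * real (N * J c + j)))"
      by (subst sum.swap) (use N in \<open>simp add: sum_shift_mod[where g = "\<lambda>j. cis (\<theta> * (real N * real (J c) + real j))"]\<close>)
    then show ?thesis using m N by (simp add: Y_def sum_subtractf flip: sum_divide_distrib)
  qed
  have Y2: "cmod (Y \<theta> c i) \<le> 2" for \<theta> c i
  proof -
    have "cmod (Y \<theta> c i) \<le> 1 + 1"
      unfolding Y_def by (intro order.trans[OF norm_triangle_ineq4] add_mono norm_average_le) auto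
    then show ?thesis by simp
  qed
  have lip: "cmod (D s \<theta> - D s \<theta>') \<le> 2 * (q * \<bar>\<theta> - \<theta>'\<bar>)" if s: "\<And>c. s c < N" for s and \<theta> \<theta>' :: real
  proof -
    have cis: "cmod (cis (\<theta> * real k) - cis (\<theta>' * real k)) \<le> q * \<bar>\<theta> - \<theta>'\<bar>" if "k < q" for k
    proof -
      have "cmod (cis (\<theta> * real k) - cis (\<theta>' * real k)) \<le> \<bar>(\<theta> - \<theta>') * real k\<bar>"
        using cmod_cis_diff[of "\<theta> * real k" "\<theta>' * real k"] by (simp add: left_diff_distrib)
      also have "\<dots> \<le> \<bar>\<theta> - \<theta>'\<bar> * real q" using that by (simp add: abs_mult mult_left_mono)
      finally show ?thesis by (simp add: mult.commute)
    qed
    have less: "N * J c + j < q" if "c < P" "j < N" for c j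
    proof -
      have "N * Suc (J c) \<le> q" using J[OF that(1)] unfolding q_def by (intro mult_le_mono2) simp
      then show ?thesis using that by simp
    qed
    have K: "0 \<le> q * \<bar>\<theta> - \<theta>'\<bar>" by simp
    have "cmod (Y \<theta> c (s c) - Y \<theta>' c (s c)) \<le> 2 * (q * \<bar>\<theta> - \<theta>'\<bar>)" if c: "c < P" for c
    proof -
      have "Y \<theta> c (s c) - Y \<theta>' c (s c) =
        (\<Sum>r<m. cis (\<theta> * real (N * J c + (A r + s c) mod N)) - cis (\<theta>' * real (N * J c + (A r + s c) mod N))) / m
        - (\<Sum>j<N. cis (\<theta> * real (N * J c + j)) - cis (\<theta>' * real (N * J c + j))) / N"
        by (simp add: Y_def sum_subtractf diff_divide_distrib)
      also have "cmod \<dots> \<le> q * \<bar>\<theta> - \<theta>'\<bar> + q * \<bar>\<theta> - \<theta>'\<bar>"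
        by (rule order.trans[OF norm_triangle_ineq4], intro add_mono norm_average_le cis less c K)
          (use N in auto)
      finally show ?thesis by simp
    qed
    then have "cmod ((\<Sum>c<P. Y \<theta> c (s c) - Y \<theta>' c (s c)) / P) \<le> 2 * (q * \<bar>\<theta> - \<theta>'\<bar>)"
      by (intro norm_average_le) auto
    then show ?thesis by (simp add: D_def sum_subtractf diff_divide_distrib)
  qed
  have period: "D s (\<theta> - 2 * pi * of_int n) = D s \<theta>" for s \<theta> n
  proof -
    have "cis ((\<theta> - 2 * pi * of_int n) * real k) = cis (\<theta> * real k)" for k
    proof -
      have "cis ((\<theta> - 2 * pi * of_int n) * real k) = cis (\<theta> * real k) / cis (2 * pi * of_int (n * int k))"
        by (simp add: cis_divide algebra_simps)
      then show ?thesis by (simp add: cis_multiple_2pi)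
    qed
    then show ?thesis unfolding D_def Y_def by (simp only:)
  qed
  \<comment> \<open>The grid covers \<open>[0, 8)\<close>, hence a full period, with mesh
    \<open>1 / q\<^sup>2\<close>; the four rotations recover the modulus from real parts.\<close>
  define G where "G = {..<8 * q\<^sup>2} \<times> {1, -1, \<i>, -\<i>}"
  \<comment> \<open>Halved because \<open>Y\<close> is only bounded by 2.\<close>
  define X where "X g c i = Re (snd g * Y (fst g / q\<^sup>2) c i) / 2" for g :: "nat \<times> complex" and c i
  have G: "finite G" "G \<noteq> {}" using q by (auto simp: G_def lessThan_empty_iff)
  have "card {1, -1, \<i>, -\<i>} \<le> 4" by (rule card_insert_le_m1 | simp)+
  then have "card G \<le> 32 * q\<^sup>2" unfolding G_def card_cartesian_product by simp
  \<comment> \<open>A pure power of \<open>q\<close> makes the logarithm a multiple of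
    \<open>ln q\<close>; this is the 7 in the bound.\<close>
  also have "32 * q\<^sup>2 \<le> q ^ 7"
  proof -
    have "2 ^ 5 \<le> q ^ 5" using q by (rule power_mono) simp
    then have "32 * q\<^sup>2 \<le> q ^ 5 * q\<^sup>2" by (intro mult_le_mono1) simp
    then show ?thesis by (simp flip: power_add)
  qed
  finally have "ln (real (card G)) \<le> ln (real (q ^ 7))"
    using G q by (subst ln_le_cancel_iff) (auto simp: card_gt_0_iff simp del: of_nat_power)
  then have L: "ln (real (card G)) \<le> 7 * ln q" using q by (simp add: ln_realpow)
  have L0: "0 < 7 * ln (real q)" using q by simp
  have bounded: "\<bar>X g c i\<bar> \<le> 1" if "g \<in> G" for g c i
  proof -
    have "\<bar>Re (snd g * Y (fst g / q\<^sup>2) c i)\<bar> \<le> cmod (snd g * Y (fst g / q\<^sup>2) c i)"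
      by (rule abs_Re_le_cmod)
    also have "\<dots> = cmod (Y (fst g / q\<^sup>2) c i)" using that by (auto simp: G_def norm_mult)
    finally show ?thesis using Y2[of "fst g / q\<^sup>2" c i] by (simp add: X_def)
  qed
  have centredX: "(\<Sum>i<N. X g c i) = 0" for g c
    using arg_cong[OF centred[of "fst g / q\<^sup>2" c], of "\<lambda>z. Re (snd g * z) / 2"]
    by (simp add: X_def sum_distrib_left Re_sum flip: sum_divide_distrib)
  obtain s where s: "\<And>c. s c < N" "\<And>g. g \<in> G \<Longrightarrow> (\<Sum>c<P. X g c (s c)) \<le> 2 * sqrt (7 * ln q * P)"
    using bounded_sums_choice[of N P G "7 * ln q" X] N P G L L0 bounded centredX by auto
  have grid: "cmod (D s (real j / q\<^sup>2)) \<le> 8 * sqrt (7 * ln q / P)" if j: "j < 8 * q\<^sup>2" for j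
  proof -
    have "cmod (\<Sum>c<P. Y (j / q\<^sup>2) c (s c)) \<le> 2 * (4 * sqrt (7 * ln q * P))"
    proof (rule cmod_le_of_rotations)
      fix w :: complex assume "w \<in> {1, -1, \<i>, -\<i>}"
      then have "(j, w) \<in> G" using j by (simp add: G_def)
      from s(2)[OF this] show "Re (w * (\<Sum>c<P. Y (j / q\<^sup>2) c (s c))) \<le> 4 * sqrt (7 * ln q * P)"
        by (simp add: X_def sum_distrib_left Re_sum flip: sum_divide_distrib)
    qed
    then have "cmod (D s (real j / q\<^sup>2)) \<le> 8 * (sqrt (7 * ln q * P) / P)"
      using P by (simp add: D_def norm_divide divide_right_mono)
    also have "sqrt (7 * ln q * P) / P = sqrt (7 * ln q / P)"
      using P by (simp add: real_sqrt_mult real_sqrt_divide field_simps)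
    finally show ?thesis .
  qed
  show thesis
  proof (rule that[of s])
    fix \<theta> :: real
    \<comment> \<open>Reduce to one period and round down to the grid; the Lipschitz bound then
      costs \<open>2 * q / q\<^sup>2\<close>, the summand \<open>2 / q\<close>.\<close>
    define n where "n = \<lfloor>\<theta> / (2 * pi)\<rfloor>"
    define \<theta>' where "\<theta>' = \<theta> - 2 * pi * of_int n"
    have "of_int n \<le> \<theta> / (2 * pi)" "\<theta> / (2 * pi) < of_int n + 1" unfolding n_def by linarith+
    then have \<theta>': "0 \<le> \<theta>'" "\<theta>' < 2 * pi" by (simp_all add: \<theta>'_def field_simps)
    then have less: "\<theta>' < 8" using pi_less_4 by simp
    define j where "j = nat \<lfloor>\<theta>' * q\<^sup>2\<rfloor>"
    have j: "real j \<le> \<theta>' * q\<^sup>2" "\<theta>' * q\<^sup>2 < real j + 1"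
      unfolding j_def using \<theta>' by (auto simp: of_nat_nat)
    have "\<theta>' * q\<^sup>2 < 8 * q\<^sup>2" using less q by simp
    then have "real j < real (8 * q\<^sup>2)" using j by simp
    then have j8: "j < 8 * q\<^sup>2" by (simp only: of_nat_less_iff)
    have "\<bar>\<theta>' - real j / q\<^sup>2\<bar> \<le> 1 / q\<^sup>2"
    proof -
      have "\<theta>' - real j / q\<^sup>2 = (\<theta>' * q\<^sup>2 - j) / q\<^sup>2" using q by (simp add: field_simps)
      then show ?thesis using j by (auto simp: divide_right_mono)
    qed
    then have "2 * (q * \<bar>\<theta>' - real j / q\<^sup>2\<bar>) \<le> 2 * (q * (1 / q\<^sup>2))" by (intro mult_left_mono) auto
    also have "\<dots> = 2 / q" by (simp add: power2_eq_square)
    finally have "cmod (D s \<theta>' - D s (real j / q\<^sup>2)) \<le> 2 / q"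
      using lip[of s \<theta>' "real j / q\<^sup>2"] s(1) by fastforce
    then have "cmod (D s \<theta>') \<le> 8 * sqrt (7 * ln q / P) + 2 / q"
      using grid[OF j8] norm_triangle_sub[of "D s \<theta>'" "D s (real j / q\<^sup>2)"] by linarith
    then show "cmod ((\<Sum>c<P. \<Sum>r<m. cis (\<theta> * real (N * J c + (A r + s c) mod N))) / real (P * m)
       - (\<Sum>c<P. \<Sum>j<N. cis (\<theta> * real (N * J c + j))) / real (P * N))
     \<le> 8 * sqrt (7 * ln q / P) + 2 / q"
      unfolding D_eq \<theta>'_def period .
  qed (use s in auto)
qed

section \<open>Shifted digit systems\<close>

text \<open>The characteristic function of the uniform distribution on \<open>[0, 1]\<close>, except that the value at \<open>0\<close> is
  \<open>0\<close> because of the division.\<close>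

definition unif_char :: "real \<Rightarrow> complex" where
  "unif_char \<theta> = (cis \<theta> - 1) / (\<i> * \<theta>)"

lemma cmod_unif_char_le_1: "cmod (unif_char \<theta>) \<le> 1"
  using cmod_cis_diff[of \<theta> 0] by (cases "\<theta> = 0") (auto simp: unif_char_def norm_divide norm_mult)

lemma cmod_unif_char_le: "cmod (unif_char \<theta>) \<le> 2 / \<bar>\<theta>\<bar>"
proof -
  have "cmod (cis \<theta> - 1) \<le> 2" using norm_triangle_ineq4[of "cis \<theta>" 1] by simp
  then show ?thesis by (simp add: unif_char_def norm_divide norm_mult divide_right_mono)
qed

text \<open>Interpolation between the bounds \<open>1\<close> and
  \<open>2 / \<bar>\<theta>\<bar>\<close>, so that the exponent can be matched to the decay wanted
  later.\<close>

lemma cmod_unif_char_le_powr: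
  assumes "\<theta> \<noteq> 0" "0 \<le> a" "a \<le> 1"
  shows "cmod (unif_char \<theta>) \<le> (2 / \<bar>\<theta>\<bar>) powr a"
proof (cases "2 / \<bar>\<theta>\<bar> \<le> 1")
  case True
  then have "(2 / \<bar>\<theta>\<bar>) powr 1 \<le> (2 / \<bar>\<theta>\<bar>) powr a" using assms by (intro powr_mono') auto
  then show ?thesis using cmod_unif_char_le[of \<theta>] assms by simp
next
  case False
  then have "1 powr a \<le> (2 / \<bar>\<theta>\<bar>) powr a" using assms by (intro powr_mono2) auto
  then show ?thesis using cmod_unif_char_le_1[of \<theta>] by simp
qed

text \<open>The uniform distribution on an interval of length \<open>N\<close> is the average of its
  \<open>N\<close> translates on unit subintervals; analytically this is the geometric series for
  \<open>cis \<alpha>\<close>.\<close>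

lemma unif_char_mult:
  assumes "\<alpha> \<noteq> 0" "0 < N"
  shows "unif_char (real N * \<alpha>) = (\<Sum>j<N. cis (\<alpha> * real j)) / N * unif_char \<alpha>"
proof -
  have "cis (real N * \<alpha>) - 1 = (cis \<alpha> - 1) * (\<Sum>j<N. cis \<alpha> ^ j)"
    unfolding Complex.DeMoivre[of \<alpha> N, symmetric] by (rule power_diff_1_eq)
  then show ?thesis
    using assms by (simp add: unif_char_def Complex.DeMoivre mult_ac)
qed

lemma tendsto_unif_char:
  assumes "(f \<longlongrightarrow> 0) F" "eventually (\<lambda>x. f x \<noteq> 0) F"
  shows "((\<lambda>x. unif_char (f x)) \<longlongrightarrow> 1) F"
proof -
  have "((\<lambda>z. exp z) has_field_derivative exp 0) (at (0::complex))"
    by (rule DERIV_exp)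
  then have exp: "((\<lambda>z. (exp z - 1) / z) \<longlongrightarrow> 1) (at (0::complex))"
    by (simp add: has_field_derivative_iff)
  have "((\<lambda>x. \<i> * complex_of_real (f x)) \<longlongrightarrow> \<i> * of_real 0) F"
    using assms(1) by (intro tendsto_intros)
  then have "filterlim (\<lambda>x. \<i> * complex_of_real (f x)) (at 0) F"
    using assms(2) by (auto simp: filterlim_at elim: eventually_mono)
  from filterlim_compose[OF exp this] show ?thesis
    by (simp add: unif_char_def cis_conv_exp)
qed

section \<open>Mixed-radix digit systems and their shifts\<close>

locale digit_system =
  fixes N m :: "nat \<Rightarrow> nat" and A :: "nat \<Rightarrow> nat \<Rightarrow> nat"
  assumes N_ge2: "2 \<le> N k" and m_pos: "0 < m k"
    and A_inj: "inj_on (A k) {..<m k}" and A_less: "r < m k \<Longrightarrow> A k r < N k"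
begin

text \<open>In the construction below, level \<open>k\<close> has \<open>P k\<close> surviving
  intervals, each of length \<open>1 / Q k\<close>.\<close>

definition P :: "nat \<Rightarrow> nat" where "P k = (\<Prod>l<k. m l)"
definition Q :: "nat \<Rightarrow> nat" where "Q k = (\<Prod>l<k. N l)"

lemma P_Suc: "P (Suc k) = P k * m k" by (simp add: P_def)
lemma Q_Suc: "Q (Suc k) = N k * Q k" by (simp add: Q_def)
lemma P_pos: "0 < P k" by (simp add: P_def m_pos prod_pos)
lemma N_pos: "0 < N k" using N_ge2[of k] by simp
lemma Q_pos: "0 < Q k" by (simp add: Q_def N_pos prod_pos)

lemma power_le_Q: "2 ^ k \<le> Q k"
proof (induction k)
  case (Suc k)
  then show ?case using mult_le_mono[OF N_ge2 Suc, of k] by (simp add: Q_Suc)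
qed (simp add: Q_def)

lemma power_le_real_Q: "2 ^ k \<le> real (Q k)"
  using of_nat_mono[OF power_le_Q[of k], where ?'a = real] by simp

lemma Q_Suc_ge2: "2 \<le> Q (Suc k)"
  using mult_le_mono[OF N_ge2[of k], of 1 "Q k"] Q_pos[of k] by (simp add: Q_Suc)

text \<open>The error delivered by \<open>shift_choice\<close> at level \<open>k\<close>, where its
  \<open>q\<close> is \<open>Q (Suc k)\<close>.\<close>

definition tolerance :: "nat \<Rightarrow> real" where
  "tolerance k = 8 * sqrt (7 * ln (Q (Suc k)) / P k) + 2 / Q (Suc k)"

end

text \<open>The interval number \<open>c\<close> of level \<open>k\<close> starts at
  \<open>J k c / Q k\<close>, and its children have the numbers \<open>c * m k + r\<close> with
  \<open>r < m k\<close>. The shift \<open>s k c\<close> belongs to the parent and is common to its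
  children. The last assumption is what \<open>shift_choice\<close> provides.\<close>

locale shifted_digits = digit_system +
  fixes J s :: "nat \<Rightarrow> nat \<Rightarrow> nat"
  assumes J_0: "J 0 c = 0"
    and J_Suc: "J (Suc k) c = N k * J k (c div m k) + (A k (c mod m k) + s k (c div m k)) mod N k"
    and discrepancy:
      "cmod ((\<Sum>c<P k. \<Sum>r<m k. cis (\<theta> * real (N k * J k c + (A k r + s k c) mod N k))) / real (P k * m k)
         - (\<Sum>c<P k. \<Sum>j<N k. cis (\<theta> * real (N k * J k c + j))) / real (P k * N k)) \<le> tolerance k"

context digit_system
begin

lemma exists_shifted_digits:
  obtains J s where "shifted_digits N m A J s"
proof -
  define R where "R k (J::nat \<Rightarrow> nat) J' s \<longleftrightarrow>
    (\<forall>c. J' c = N k * J (c div m k) + (A k (c mod m k) + s (c div m k)) mod N k) \<and>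
    (\<forall>\<theta>. cmod ((\<Sum>c<P k. \<Sum>r<m k. cis (\<theta> * real (N k * J c + (A k r + s c) mod N k))) / real (P k * m k)
         - (\<Sum>c<P k. \<Sum>j<N k. cis (\<theta> * real (N k * J c + j))) / real (P k * N k)) \<le> tolerance k)"
    for k J J' s
  \<comment> \<open>The bound \<open>J c < Q k\<close> is carried along because
    \<open>shift_choice\<close> requires it; the second part fixes the starting point.\<close>
  define S where "S k J \<longleftrightarrow> (\<forall>c<P k. J c < Q k) \<and> (k = 0 \<longrightarrow> J = (\<lambda>_. 0))"
    for k and J :: "nat \<Rightarrow> nat"
  have "\<exists>J. \<forall>k. S k (J k) \<and> (\<exists>s. R k (J k) (J (Suc k)) s)"
  proof (rule dependent_nat_choice)
    show "\<exists>J. S 0 J" using Q_pos by (intro exI[of _ "\<lambda>_. 0"]) (simp add: S_def)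
    fix J k assume J: "S k J"
    then have J': "\<And>c. c < P k \<Longrightarrow> J c < Q k" by (simp add: S_def)
    obtain s where "\<And>\<theta>. cmod ((\<Sum>c<P k. \<Sum>r<m k. cis (\<theta> * real (N k * J c + (A k r + s c) mod N k))) / real (P k * m k)
         - (\<Sum>c<P k. \<Sum>j<N k. cis (\<theta> * real (N k * J c + j))) / real (P k * N k))
       \<le> 8 * sqrt (7 * ln (real (N k * Q k)) / P k) + 2 / real (N k * Q k)"
      by (rule shift_choice[OF P_pos[of k] m_pos[of k] N_ge2[of k] Q_pos[of k] J', where A = "A k"]) (assumption, rule that)
    then have "R k J (\<lambda>c. N k * J (c div m k) + (A k (c mod m k) + s (c div m k)) mod N k) s"
      unfolding R_def tolerance_def Q_Suc by blast
    moreover have "S (Suc k) (\<lambda>c. N k * J (c div m k) + (A k (c mod m k) + s (c div m k)) mod N k)"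
      unfolding S_def
    proof (intro conjI allI impI)
      fix c assume "c < P (Suc k)"
      then have "c div m k < P k" by (simp add: P_Suc less_mult_imp_div_less)
      then have "J (c div m k) < Q k" using J by (simp add: S_def)
      then have "N k * Suc (J (c div m k)) \<le> Q (Suc k)" unfolding Q_Suc by (intro mult_le_mono2) simp
      moreover have "(A k (c mod m k) + s (c div m k)) mod N k < N k" using N_pos by simp
      ultimately show "N k * J (c div m k) + (A k (c mod m k) + s (c div m k)) mod N k < Q (Suc k)"
        unfolding mult_Suc_right by linarith
    qed simp
    ultimately show "\<exists>J'. S (Suc k) J' \<and> (\<exists>s. R k J J' s)" by blast
  qed
  then obtain J s where "\<And>k. S k (J k)" "\<And>k. R k (J k) (J (Suc k)) (s k)" by metis
  then have "shifted_digits N m A J s"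
    by unfold_locales (auto simp: R_def S_def)
  then show thesis by (rule that)
qed

end

context shifted_digits
begin

lemma J_Suc_div_mod: "J (Suc k) c div N k = J k (c div m k)"
  "J (Suc k) c mod N k = (A k (c mod m k) + s k (c div m k)) mod N k"
  using N_pos[of k] by (simp_all add: J_Suc)

text \<open>Quotient and remainder by \<open>N k\<close> recover the parent and the shifted digit,
  and a cyclic shift is injective on digits below \<open>N k\<close>.\<close>

lemma J_inj: "inj_on (J k) {..<P k}"
proof (induction k)
  case 0
  show ?case by (simp add: P_def inj_on_def)
next
  case (Suc k)
  show ?case
  proof (rule inj_onI)
    fix c d assume cd: "c \<in> {..<P (Suc k)}" "d \<in> {..<P (Suc k)}" "J (Suc k) c = J (Suc k) d"
    then have "J k (c div m k) = J k (d div m k)" using J_Suc_div_mod by metis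
    then have div: "c div m k = d div m k"
      using Suc cd by (auto simp: P_Suc less_mult_imp_div_less dest!: inj_onD)
    define i where "i = s k (d div m k)"
    have "(A k (c mod m k) + i) mod N k = (A k (d mod m k) + i) mod N k"
      using cd J_Suc_div_mod(2) div unfolding i_def by metis
    moreover have less: "A k (c mod m k) < N k" "A k (d mod m k) < N k" using A_less m_pos by auto
    moreover have "a = b" if "(a + i) mod N k = (b + i) mod N k" "a < N k" "b < N k" for a b :: nat
    proof -
      have "a = b" if "(a + i) mod N k = (b + i) mod N k" "a < N k" "b < N k" "b \<le> a" for a b
      proof -
        have "N k dvd a - b" using that mod_eq_dvd_iff_nat[of "b + i" "a + i" "N k"] by auto
        then show ?thesis using that by (auto dest!: dvd_imp_le)
      qed
      then show ?thesis using that by (metis nat_le_linear)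
    qed
    ultimately have "A k (c mod m k) = A k (d mod m k)" by blast
    then have "c mod m k = d mod m k" using inj_onD[OF A_inj] m_pos by simp
    then show "c = d" using div by (metis div_mult_mod_eq)
  qed
qed

text \<open>Multiplied by \<open>unif_char (\<xi> / Q k)\<close>, for nonzero \<open>\<xi>\<close>,
  this is the characteristic function of the measure that is uniform on the intervals of level
  \<open>k\<close>.\<close>

definition trig_mean :: "nat \<Rightarrow> real \<Rightarrow> complex" where
  "trig_mean k \<xi> = (\<Sum>c<P k. cis (\<xi> * real (J k c) / Q k)) / P k"

text \<open>Keeping all \<open>N k\<close> subintervals of each interval would not change the
  measure, by \<open>unif_char_mult\<close>. Only the selection of \<open>m k\<close> of them does,
  and \<open>discrepancy\<close> bounds its effect.\<close>

lemma trig_mean_step: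
  assumes "\<xi> \<noteq> 0"
  shows "cmod (trig_mean (Suc k) \<xi> * unif_char (\<xi> / Q (Suc k)) - trig_mean k \<xi> * unif_char (\<xi> / Q k))
    \<le> tolerance k * cmod (unif_char (\<xi> / Q (Suc k)))"
proof -
  define \<theta> where "\<theta> = \<xi> / Q (Suc k)"
  have \<theta>: "\<theta> \<noteq> 0" using assms Q_pos[of "Suc k"] by (simp add: \<theta>_def)
  have \<xi>: "\<xi> / Q k = real (N k) * \<theta>" using Q_pos[of k] N_pos[of k] by (simp add: \<theta>_def Q_Suc)
  have "(\<Sum>c<P (Suc k). cis (\<xi> * real (J (Suc k) c) / Q (Suc k)))
      = (\<Sum>c<P k. \<Sum>r<m k. cis (\<theta> * real (J (Suc k) (c * m k + r))))"
  proof -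
    have "(\<Sum>c<P (Suc k). cis (\<xi> * real (J (Suc k) c) / Q (Suc k)))
      = (\<Sum>c<P k. sum (\<lambda>c. cis (\<theta> * real (J (Suc k) c))) {c * m k..<c * m k + m k})"
      by (subst sum.nat_group) (simp add: P_Suc \<theta>_def)
    also have "\<dots> = (\<Sum>c<P k. \<Sum>r<m k. cis (\<theta> * real (J (Suc k) (c * m k + r))))"
      by (simp add: sum.atLeastLessThan_shift_0[of _ "_ * m k"] atLeast0LessThan add.commute)
    finally show ?thesis .
  qed
  also have "\<dots> = (\<Sum>c<P k. \<Sum>r<m k. cis (\<theta> * real (N k * J k c + (A k r + s k c) mod N k)))"
    by (intro sum.cong refl) (simp add: J_Suc)
  finally have 1: "trig_mean (Suc k) \<xi>
      = (\<Sum>c<P k. \<Sum>r<m k. cis (\<theta> * real (N k * J k c + (A k r + s k c) mod N k))) / real (P k * m k)"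
    by (simp add: trig_mean_def P_Suc)
  have "(\<Sum>c<P k. \<Sum>j<N k. cis (\<theta> * real (N k * J k c + j)))
      = (\<Sum>c<P k. \<Sum>j<N k. cis (\<xi> * real (J k c) / Q k) * cis (\<theta> * real j))"
    using arg_cong[OF \<xi>, of "\<lambda>x. x * real (J k _)"]
    by (intro sum.cong refl) (simp add: cis_mult algebra_simps)
  then have "(\<Sum>c<P k. \<Sum>j<N k. cis (\<theta> * real (N k * J k c + j))) / real (P k * N k)
      = trig_mean k \<xi> * ((\<Sum>j<N k. cis (\<theta> * real j)) / N k)"
    by (simp add: trig_mean_def flip: sum_product)
  then have "trig_mean k \<xi> * unif_char (\<xi> / Q k)
      = (\<Sum>c<P k. \<Sum>j<N k. cis (\<theta> * real (N k * J k c + j))) / real (P k * N k) * unif_char \<theta>"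
    using unif_char_mult[OF \<theta> N_pos] \<xi> by simp
  then have "trig_mean (Suc k) \<xi> * unif_char \<theta> - trig_mean k \<xi> * unif_char (\<xi> / Q k)
     = ((\<Sum>c<P k. \<Sum>r<m k. cis (\<theta> * real (N k * J k c + (A k r + s k c) mod N k))) / real (P k * m k)
         - (\<Sum>c<P k. \<Sum>j<N k. cis (\<theta> * real (N k * J k c + j))) / real (P k * N k)) * unif_char \<theta>"
    unfolding 1 by (simp only: left_diff_distrib)
  then show ?thesis using discrepancy[of \<theta> k] by (simp add: norm_mult mult_right_mono flip: \<theta>_def)
qed

lemma trig_mean_0: "trig_mean 0 \<xi> = 1"
  by (simp add: trig_mean_def P_def J_0)

text \<open>The steps telescope, starting at level 0 from the uniform distribution on the unit
  interval.\<close>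

lemma trig_mean_bound:
  assumes "\<xi> \<noteq> 0"
  shows "cmod (trig_mean k \<xi> * unif_char (\<xi> / Q k))
    \<le> cmod (unif_char \<xi>) + (\<Sum>l<k. tolerance l * cmod (unif_char (\<xi> / Q (Suc l))))"
proof (induction k)
  case 0
  show ?case by (simp add: trig_mean_0 Q_def)
next
  case (Suc k)
  show ?case
    using Suc.IH trig_mean_step[OF assms, of k]
      norm_triangle_sub[of "trig_mean (Suc k) \<xi> * unif_char (\<xi> / Q (Suc k))" "trig_mean k \<xi> * unif_char (\<xi> / Q k)"]
    by simp
qed

end

section \<open>Decay of the trigonometric means\<close>

context digit_system
begin

text \<open>The growth condition is applied with an exponent slightly above \<open>\<beta>\<close>;
  the surplus \<open>\<delta>\<close> absorbs the logarithm.\<close>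

lemma tolerance_le:
  assumes growth: "\<And>\<beta>. \<beta> < 1 \<Longrightarrow> \<exists>C::real. 0 < C \<and> (\<forall>k. Q (Suc k) powr \<beta> \<le> C * P k)" and \<beta>: "\<beta> < 1"
  obtains C where "0 < C" "\<And>k. tolerance k \<le> C * Q (Suc k) powr (- \<beta> / 2)"
proof -
  define \<delta> where "\<delta> = (1 - \<beta>) / 2"
  have \<delta>: "0 < \<delta>" "\<beta> + \<delta> < 1" using \<beta> by (simp_all add: \<delta>_def field_simps)
  obtain C :: real where C: "0 < C" "\<And>k. Q (Suc k) powr (\<beta> + \<delta>) \<le> C * P k" using growth[OF \<delta>(2)] by metis
  show thesis
  proof (rule that[of "8 * sqrt (7 * C / \<delta>) + 2"])
    show "0 < 8 * sqrt (7 * C / \<delta>) + 2" using C \<delta> by (intro add_nonneg_pos) auto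
    fix k
    define q where "q = real (Q (Suc k))"
    have q: "2 \<le> q" using Q_Suc_ge2[of k] by (simp add: q_def)
    have "ln q / P k \<le> (q powr \<delta> / \<delta>) * (C / q powr (\<beta> + \<delta>))"
    proof -
      have "1 / P k \<le> C / q powr (\<beta> + \<delta>)"
        using C(2)[of k] P_pos[of k] q by (simp add: q_def field_simps)
      then have "ln q * (1 / P k) \<le> (q powr \<delta> / \<delta>) * (C / q powr (\<beta> + \<delta>))"
        using q \<delta> by (intro mult_mono ln_powr_bound) auto
      then show ?thesis by simp
    qed
    also have "\<dots> = C / \<delta> * q powr (- \<beta>)"
      using q by (simp add: powr_add powr_minus field_simps)
    finally have "7 * ln q / P k \<le> 7 * C / \<delta> * q powr (- \<beta>)" by simp
    then have "sqrt (7 * ln q / P k) \<le> sqrt (7 * C / \<delta> * q powr (- \<beta>))" by (rule real_sqrt_le_mono)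
    also have "\<dots> = sqrt (7 * C / \<delta>) * q powr (- \<beta> / 2)"
      using q by (simp only: real_sqrt_mult) (use powr_half_sqrt_powr[of q "- \<beta>"] in simp)
    finally have 1: "sqrt (7 * ln q / P k) \<le> sqrt (7 * C / \<delta>) * q powr (- \<beta> / 2)" .
    have "q powr (-1) \<le> q powr (- \<beta> / 2)" using q \<beta> by (intro powr_mono) auto
    then have "2 / q \<le> 2 * q powr (- \<beta> / 2)" using q by (simp add: powr_minus_divide)
    with 1 show "tolerance k \<le> (8 * sqrt (7 * C / \<delta>) + 2) * Q (Suc k) powr (- \<beta> / 2)"
      unfolding tolerance_def by (simp add: q_def algebra_simps)
  qed
qed

end

context shifted_digits
begin

text \<open>In the summands of \<open>trig_mean_bound\<close>, interpolation with exponent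
  \<open>\<beta> / 2\<close> bounds \<open>unif_char\<close> at the cost of a factor
  \<open>Q (Suc l) powr (\<beta> / 2)\<close>. The tolerance decays faster than this by
  \<open>Q (Suc l) powr (- \<delta>)\<close>, and \<open>Q (Suc l) \<ge> 2 ^ l\<close> makes the sum
  geometric, uniformly in \<open>k\<close>.\<close>

lemma trig_mean_decay:
  assumes growth: "\<And>\<beta>. \<beta> < 1 \<Longrightarrow> \<exists>C::real. 0 < C \<and> (\<forall>k. Q (Suc k) powr \<beta> \<le> C * P k)" and \<beta>: "0 \<le> \<beta>" "\<beta> < 1"
  obtains C where "0 < C"
    "\<And>k \<xi>. \<xi> \<noteq> 0 \<Longrightarrow> cmod (trig_mean k \<xi> * unif_char (\<xi> / Q k)) \<le> C * \<bar>\<xi>\<bar> powr (- \<beta> / 2)"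
proof -
  define \<delta> where "\<delta> = (1 - \<beta>) / 4"
  have \<delta>: "0 < \<delta>" "\<beta> + 2 * \<delta> < 1" using \<beta> by (simp_all add: \<delta>_def field_simps)
  obtain C where C: "0 < C" "\<And>k. tolerance k \<le> C * Q (Suc k) powr (- (\<beta> + 2 * \<delta>) / 2)"
    using tolerance_le[OF growth \<delta>(2)] by blast
  define x where "x = (2::real) powr (- \<delta>)"
  have x: "0 < x" "x < 1" using \<delta> by (auto simp: x_def powr_less_one)
  define a where "a = \<beta> / 2"
  have a: "0 \<le> a" "a \<le> 1" using \<beta> by (auto simp: a_def)
  have summand: "tolerance l * cmod (unif_char (\<xi> / Q (Suc l))) \<le> C * 2 powr a * \<bar>\<xi>\<bar> powr (- a) * x ^ l"
    if \<xi>: "\<xi> \<noteq> 0" for l \<xi>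
  proof -
    define q where "q = real (Q (Suc l))"
    have "(2::real) ^ l \<le> 2 ^ Suc l" by simp
    also have "\<dots> \<le> q" unfolding q_def by (rule power_le_real_Q)
    finally have q: "2 ^ l \<le> q" "0 < q" using Q_pos[of "Suc l"] by (auto simp: q_def)
    have "cmod (unif_char (\<xi> / q)) \<le> (2 / \<bar>\<xi> / q\<bar>) powr a"
      using \<xi> q a by (intro cmod_unif_char_le_powr) auto
    also have "2 / \<bar>\<xi> / q\<bar> = 2 * q / \<bar>\<xi>\<bar>" using q by (simp add: abs_divide)
    also have "(2 * q / \<bar>\<xi>\<bar>) powr a = 2 powr a * q powr a * \<bar>\<xi>\<bar> powr (- a)"
      using q \<xi> by (simp add: powr_divide powr_mult powr_minus divide_simps)
    finally have h: "cmod (unif_char (\<xi> / q)) \<le> 2 powr a * q powr a * \<bar>\<xi>\<bar> powr (- a)" .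
    have "tolerance l * cmod (unif_char (\<xi> / q))
        \<le> (C * q powr (- (\<beta> + 2 * \<delta>) / 2)) * (2 powr a * q powr a * \<bar>\<xi>\<bar> powr (- a))"
      using C h by (intro mult_mono) (auto simp: q_def)
    also have "\<dots> = C * 2 powr a * \<bar>\<xi>\<bar> powr (- a) * (q powr (- (\<beta> + 2 * \<delta>) / 2) * q powr a)" by simp
    also have "q powr (- (\<beta> + 2 * \<delta>) / 2) * q powr a = q powr (- \<delta>)"
      by (simp add: a_def field_simps flip: powr_add)
    also have "C * 2 powr a * \<bar>\<xi>\<bar> powr (- a) * q powr (- \<delta>) \<le> C * 2 powr a * \<bar>\<xi>\<bar> powr (- a) * (2 ^ l) powr (- \<delta>)"
      using q \<delta> C by (intro mult_left_mono powr_mono2') auto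
    also have "(2 ^ l) powr (- \<delta>) = x ^ l"
      by (simp add: x_def powr_powr powr_realpow[symmetric] mult.commute)
    finally show ?thesis by (simp add: q_def)
  qed
  define D where "D = 2 powr a + C * 2 powr a / (1 - x)"
  show thesis
  proof (rule that[of D])
    show "0 < D" using C x by (auto simp: D_def intro!: add_pos_pos)
    fix k and \<xi> :: real assume \<xi>: "\<xi> \<noteq> 0"
    have "(\<Sum>l<k. x ^ l) \<le> 1 / (1 - x)"
      using x sum_le_suminf[of "\<lambda>l. x ^ l" "{..<k}"] by (simp add: suminf_geometric summable_geometric)
    then have "(\<Sum>l<k. C * 2 powr a * \<bar>\<xi>\<bar> powr (- a) * x ^ l) \<le> C * 2 powr a * \<bar>\<xi>\<bar> powr (- a) * (1 / (1 - x))"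
      using C by (simp only: flip: sum_distrib_left) (intro mult_left_mono; simp)
    then have 1: "(\<Sum>l<k. tolerance l * cmod (unif_char (\<xi> / Q (Suc l)))) \<le> C * 2 powr a * \<bar>\<xi>\<bar> powr (- a) * (1 / (1 - x))"
      using sum_mono[of "{..<k}" "\<lambda>l. tolerance l * cmod (unif_char (\<xi> / Q (Suc l)))"] summand[OF \<xi>] by (meson order.trans)
    have 2: "cmod (unif_char \<xi>) \<le> 2 powr a * \<bar>\<xi>\<bar> powr (- a)"
      using cmod_unif_char_le_powr[OF \<xi> a] \<xi> by (simp add: powr_divide powr_minus field_simps)
    have "cmod (trig_mean k \<xi> * unif_char (\<xi> / Q k)) \<le> D * \<bar>\<xi>\<bar> powr (- a)"
      using trig_mean_bound[OF \<xi>, of k] 1 2 by (simp add: D_def algebra_simps)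
    then show "cmod (trig_mean k \<xi> * unif_char (\<xi> / Q k)) \<le> D * \<bar>\<xi>\<bar> powr (- \<beta> / 2)"
      by (simp add: a_def)
  qed
qed

end

section \<open>The limiting measure\<close>

abbreviation unit_uniform :: "real measure" where
  "unit_uniform \<equiv> uniform_measure lborel {0..<1}"

lemma prob_space_unit_uniform: "prob_space unit_uniform"
  by (rule prob_space_uniform_measure) auto

lemma AE_unit_uniform: "(\<And>\<omega>. 0 \<le> \<omega> \<Longrightarrow> \<omega> < 1 \<Longrightarrow> R \<omega>) \<Longrightarrow> AE \<omega> in unit_uniform. R \<omega>"
  by (subst AE_uniform_measure) auto

context shifted_digits
begin

text \<open>For \<open>\<omega>\<close> uniform in \<open>[0, 1)\<close> every cell of level
  \<open>k\<close> has probability \<open>1 / P k\<close>, and the cells of successive levels are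
  nested by \<open>cell_Suc\<close>. The limit measure thus arises as an image of the uniform
  one.\<close>

definition cell :: "nat \<Rightarrow> real \<Rightarrow> nat" where
  "cell k \<omega> = nat \<lfloor>real (P k) * \<omega>\<rfloor>"

definition approx :: "nat \<Rightarrow> real \<Rightarrow> real" where
  "approx k \<omega> = real (J k (cell k \<omega>)) / Q k"

definition coded :: "real \<Rightarrow> real" where
  "coded \<omega> = lim (\<lambda>k. approx k \<omega>)"

definition law :: "real measure" where
  "law = distr unit_uniform borel coded"

text \<open>With half-open cells every point has a unique digit sequence; the price is that \<open>law\<close> must be shown
  not to charge the end points.\<close>

definition limit_set :: "real set" where
  "limit_set = {x. 0 \<le> x \<and> x < 1 \<and> (\<forall>k. \<exists>c<P k. \<lfloor>real (Q k) * x\<rfloor> = int (J k c))}"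

lemma cell_eq_iff:
  assumes "0 \<le> \<omega>"
  shows "cell k \<omega> = c \<longleftrightarrow> \<omega> \<in> {real c / P k..<(real c + 1) / P k}"
proof -
  have "cell k \<omega> = c \<longleftrightarrow> \<lfloor>real (P k) * \<omega>\<rfloor> = int c"
    using assms by (auto simp: cell_def)
  also have "\<dots> \<longleftrightarrow> real c \<le> P k * \<omega> \<and> P k * \<omega> < real c + 1"
    by (simp add: floor_eq_iff)
  also have "\<dots> \<longleftrightarrow> \<omega> \<in> {real c / P k..<(real c + 1) / P k}"
    using P_pos[of k] by (simp add: field_simps)
  finally show ?thesis .
qed

lemma cell_less:
  assumes "0 \<le> \<omega>" "\<omega> < 1"
  shows "cell k \<omega> < P k"
proof -
  have "real (P k) * \<omega> < P k" using assms P_pos[of k] by simp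
  then show ?thesis using assms by (simp add: cell_def floor_less_iff nat_less_iff)
qed

lemma cell_Suc:
  assumes "0 \<le> \<omega>"
  shows "cell (Suc k) \<omega> div m k = cell k \<omega>"
proof -
  have "\<lfloor>real (P k) * \<omega>\<rfloor> = \<lfloor>(real (P (Suc k)) * \<omega>) / real_of_int (int (m k))\<rfloor>"
    using m_pos[of k] by (simp add: P_Suc)
  also have "\<dots> = \<lfloor>real (P (Suc k)) * \<omega>\<rfloor> div int (m k)"
    by (rule floor_divide_real_eq_div) simp
  finally show ?thesis using assms by (simp add: cell_def nat_div_distrib)
qed

lemma measure_cell:
  assumes "c < P k"
  shows "measure unit_uniform {real c / P k..<(real c + 1) / P k} = 1 / P k"
proof -
  have "{real c / P k..<(real c + 1) / P k} \<subseteq> {0..<1}"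
    using assms P_pos[of k] by (auto simp: field_simps)
  then have "{0..<1} \<inter> {real c / P k..<(real c + 1) / P k} = {real c / P k..<(real c + 1) / P k}" by blast
  then show ?thesis using P_pos[of k] by (simp add: field_simps)
qed

lemma measurable_cell [measurable]: "cell k \<in> measurable borel (count_space UNIV)"
  unfolding cell_def by measurable

lemma measurable_approx [measurable]: "approx k \<in> borel_measurable borel"
  unfolding approx_def by measurable

lemma measurable_coded [measurable]: "coded \<in> borel_measurable borel"
  unfolding coded_def by measurable

lemma integral_cell:
  fixes g :: "nat \<Rightarrow> complex"
  shows "(CLINT \<omega>|unit_uniform. g (cell k \<omega>)) = (\<Sum>c<P k. g c) / P k"
proof -
  interpret prob_space unit_uniform by (rule prob_space_unit_uniform)
  let ?I = "\<lambda>c. {real c / P k..<(real c + 1) / P k}"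
  have "(CLINT \<omega>|unit_uniform. g (cell k \<omega>)) = (CLINT \<omega>|unit_uniform. (\<Sum>c<P k. indicator (?I c) \<omega> *\<^sub>R g c))"
  proof (rule integral_cong_AE)
    show "AE \<omega> in unit_uniform. g (cell k \<omega>) = (\<Sum>c<P k. indicator (?I c) \<omega> *\<^sub>R g c)"
    proof (rule AE_unit_uniform)
      fix \<omega> :: real assume \<omega>: "0 \<le> \<omega>" "\<omega> < 1"
      have "(\<Sum>c<P k. indicator (?I c) \<omega> *\<^sub>R g c) = (\<Sum>c<P k. if c = cell k \<omega> then g c else 0)"
        unfolding indicator_def cell_eq_iff[OF \<omega>(1), symmetric] by (intro sum.cong refl) auto
      then show "g (cell k \<omega>) = (\<Sum>c<P k. indicator (?I c) \<omega> *\<^sub>R g c)"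
        using cell_less[OF \<omega>] by simp
    qed
    show "(\<lambda>\<omega>. \<Sum>c<P k. indicator (?I c) \<omega> *\<^sub>R g c) \<in> borel_measurable unit_uniform"
      by (intro borel_measurable_sum borel_measurable_scaleR borel_measurable_indicator) simp_all
  qed simp
  also have "has_bochner_integral unit_uniform (\<lambda>\<omega>. \<Sum>c<P k. indicator (?I c) \<omega> *\<^sub>R g c)
      (\<Sum>c<P k. measure unit_uniform (?I c) *\<^sub>R g c)"
    by (intro has_bochner_integral_sum has_bochner_integral_indicator)
      (auto simp: emeasure_eq_measure simp del: emeasure_uniform_measure measure_uniform_measure)
  then have "(CLINT \<omega>|unit_uniform. (\<Sum>c<P k. indicator (?I c) \<omega> *\<^sub>R g c))
      = (\<Sum>c<P k. measure unit_uniform (?I c) *\<^sub>R g c)"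
    by (rule has_bochner_integral_integral_eq)
  also have "\<dots> = (\<Sum>c<P k. g c) / P k"
    by (simp add: measure_cell scaleR_conv_of_real sum_divide_distrib del: measure_uniform_measure)
  finally show ?thesis .
qed

text \<open>The intervals from \<open>approx k \<omega>\<close> to
  \<open>approx k \<omega> + 1 / Q k\<close> are nested, because the next digit is below
  \<open>N k\<close>.\<close>

lemma approx_Suc:
  assumes "0 \<le> \<omega>"
  shows "approx k \<omega> \<le> approx (Suc k) \<omega>"
    "approx (Suc k) \<omega> + 1 / Q (Suc k) \<le> approx k \<omega> + 1 / Q k"
proof -
  define d where "d = J (Suc k) (cell (Suc k) \<omega>) mod N k"
  have "J (Suc k) (cell (Suc k) \<omega>) = N k * J k (cell k \<omega>) + d"
    unfolding d_def by (metis cell_Suc[OF assms] J_Suc_div_mod(1) mult_div_mod_eq)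
  moreover have "d < N k" using N_pos by (simp add: d_def)
  then have "(real d + 1) * Q k \<le> real (N k) * Q k" by (intro mult_right_mono) auto
  ultimately show "approx k \<omega> \<le> approx (Suc k) \<omega>"
    "approx (Suc k) \<omega> + 1 / Q (Suc k) \<le> approx k \<omega> + 1 / Q k"
    using N_pos[of k] Q_pos[of k] by (simp_all add: approx_def Q_Suc field_simps)
qed

lemma coded_bounds:
  assumes "0 \<le> \<omega>"
  shows "(\<lambda>k. approx k \<omega>) \<longlonglongrightarrow> coded \<omega>" "approx k \<omega> \<le> coded \<omega>" "coded \<omega> \<le> approx k \<omega> + 1 / Q k"
proof -
  have inc: "incseq (\<lambda>k. approx k \<omega>)" and dec: "decseq (\<lambda>k. approx k \<omega> + 1 / Q k)"
    using approx_Suc[OF assms] by (auto intro!: incseq_SucI decseq_SucI)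
  have le: "approx l \<omega> \<le> approx k \<omega> + 1 / Q k" for k l
  proof -
    have "approx l \<omega> \<le> approx (max k l) \<omega>" by (rule incseqD[OF inc]) simp
    also have "\<dots> \<le> approx (max k l) \<omega> + 1 / Q (max k l)" by simp
    also have "\<dots> \<le> approx k \<omega> + 1 / Q k" using decseqD[OF dec, of k "max k l"] by simp
    finally show ?thesis .
  qed
  have "\<forall>l. approx l \<omega> \<le> approx 0 \<omega> + 1 / Q 0" by (intro allI le)
  from incseq_convergent[OF inc this] obtain L where L: "(\<lambda>k. approx k \<omega>) \<longlonglongrightarrow> L" .
  then have coded: "coded \<omega> = L" by (simp add: coded_def limI)
  show "(\<lambda>k. approx k \<omega>) \<longlonglongrightarrow> coded \<omega>" using L coded by simp
  show "approx k \<omega> \<le> coded \<omega>" using incseq_le[OF inc L] coded by simp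
  show "coded \<omega> \<le> approx k \<omega> + 1 / Q k" unfolding coded using le by (intro LIMSEQ_le_const2[OF L]) simp
qed

section \<open>The limit measure: Fourier transform, support and dimension\<close>

lemma prob_space_law: "prob_space law"
  unfolding law_def by (rule prob_space.prob_space_distr[OF prob_space_unit_uniform]) simp

lemma sets_law: "sets law = sets borel"
  by (simp add: law_def)

text \<open>Dominated convergence, since \<open>trig_mean k\<close> is the characteristic function
  of \<open>approx k\<close> under \<open>unit_uniform\<close>.\<close>

lemma trig_mean_tendsto_char: "(\<lambda>k. trig_mean k \<xi>) \<longlonglongrightarrow> char law \<xi>"
proof -
  interpret prob_space unit_uniform by (rule prob_space_unit_uniform)
  have "(\<lambda>k. CLINT \<omega>|unit_uniform. iexp (\<xi> * approx k \<omega>)) \<longlonglongrightarrow> (CLINT \<omega>|unit_uniform. iexp (\<xi> * coded \<omega>))"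
  proof (rule integral_dominated_convergence[where w = "\<lambda>_. 1"])
    show "AE \<omega> in unit_uniform. (\<lambda>k. iexp (\<xi> * approx k \<omega>)) \<longlonglongrightarrow> iexp (\<xi> * coded \<omega>)"
      by (rule AE_unit_uniform) (intro tendsto_intros coded_bounds)
  qed simp_all
  moreover have "(CLINT \<omega>|unit_uniform. iexp (\<xi> * approx k \<omega>)) = trig_mean k \<xi>" for k
    using integral_cell[of "\<lambda>c. iexp (\<xi> * (real (J k c) / Q k))" k]
    by (simp add: approx_def trig_mean_def cis_conv_exp)
  moreover have "char law \<xi> = (CLINT \<omega>|unit_uniform. iexp (\<xi> * coded \<omega>))"
    by (simp add: char_def law_def integral_distr)
  ultimately show ?thesis by simp
qed

text \<open>As \<open>\<xi> / Q k\<close> tends to 0, the factor \<open>unif_char\<close> tends to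
  1, so a bound uniform in \<open>k\<close> passes to the limit.\<close>

lemma cmod_char_law_le:
  assumes "\<xi> \<noteq> 0" and bound: "\<And>k. cmod (trig_mean k \<xi> * unif_char (\<xi> / Q k)) \<le> B"
  shows "cmod (char law \<xi>) \<le> B"
proof -
  have lim0: "(\<lambda>k. \<xi> / Q k) \<longlonglongrightarrow> 0"
  proof (rule Lim_null_comparison)
    have "norm (\<xi> / real (Q k)) \<le> \<bar>\<xi>\<bar> * (1 / 2) ^ k" for k
    proof -
      have "\<bar>\<xi>\<bar> / real (Q k) \<le> \<bar>\<xi>\<bar> / 2 ^ k"
        using power_le_real_Q[of k] by (intro divide_left_mono) (auto simp: Q_pos)
      then show ?thesis by (simp add: power_divide)
    qed
    then show "\<forall>\<^sub>F k in sequentially. norm (\<xi> / real (Q k)) \<le> \<bar>\<xi>\<bar> * (1 / 2) ^ k" by simp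
    show "(\<lambda>k. \<bar>\<xi>\<bar> * (1 / 2) ^ k) \<longlonglongrightarrow> 0"
      by (intro tendsto_mult_right_zero LIMSEQ_realpow_zero) auto
  qed
  have "(\<lambda>k. unif_char (\<xi> / Q k)) \<longlonglongrightarrow> 1"
    using assms(1) Q_pos by (intro tendsto_unif_char[OF lim0] always_eventually) auto
  from tendsto_norm[OF tendsto_mult[OF trig_mean_tendsto_char[of \<xi>] this]]
  show ?thesis using LIMSEQ_le_const2 bound by fastforce
qed

lemma measurable_limit_set: "limit_set \<in> sets borel"
  unfolding limit_set_def by measurable

text \<open>A point lies in at most two closed intervals of level \<open>k\<close>, so its mass is
  at most \<open>2 / P k\<close>. The growth condition with exponent \<open>1/2\<close> makes
  \<open>P k\<close> grow exponentially.\<close>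

lemma AE_coded_neq:
  assumes growth: "\<And>\<beta>. \<beta> < 1 \<Longrightarrow> \<exists>C::real. 0 < C \<and> (\<forall>k. Q (Suc k) powr \<beta> \<le> C * P k)"
  shows "AE \<omega> in unit_uniform. coded \<omega> \<noteq> x"
proof -
  interpret prob_space unit_uniform by (rule prob_space_unit_uniform)
  let ?I = "\<lambda>k c. {real c / P k..<(real c + 1) / P k}"
  define S where "S = {\<omega>. 0 \<le> \<omega> \<and> \<omega> < 1 \<and> coded \<omega> = x}"
  have S: "S \<in> sets borel" unfolding S_def by measurable
  have le: "prob S \<le> 2 / P k" for k
  proof -
    \<comment> \<open>Two candidates, because \<open>x\<close> may be the right end point of one
      interval and the left end point of the next; \<open>J_inj\<close> excludes repeated
      intervals.\<close>
    define Z where "Z = {c. c < P k \<and> int (J k c) \<in> {\<lfloor>Q k * x\<rfloor> - 1, \<lfloor>Q k * x\<rfloor>}}"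
    have Z: "finite Z" by (simp add: Z_def)
    have "card Z \<le> card {\<lfloor>Q k * x\<rfloor> - 1, \<lfloor>Q k * x\<rfloor>}"
    proof (rule card_inj_on_le)
      show "inj_on (\<lambda>c. int (J k c)) Z"
        using J_inj[of k] by (auto simp: inj_on_def Z_def)
    qed (auto simp: Z_def)
    then have card: "real (card Z) \<le> 2" by simp
    have "S \<subseteq> (\<Union>c\<in>Z. ?I k c)"
    proof
      fix \<omega> assume "\<omega> \<in> S"
      then have \<omega>: "0 \<le> \<omega>" "\<omega> < 1" "coded \<omega> = x" by (auto simp: S_def)
      have "real (J k (cell k \<omega>)) \<le> Q k * x" "Q k * x \<le> real (J k (cell k \<omega>)) + 1"
        using coded_bounds(2,3)[OF \<omega>(1), of k] \<omega>(3) Q_pos[of k] by (simp_all add: approx_def field_simps)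
      then have "int (J k (cell k \<omega>)) \<le> \<lfloor>Q k * x\<rfloor>" "\<lfloor>Q k * x\<rfloor> \<le> int (J k (cell k \<omega>)) + 1"
        by linarith+
      then have "cell k \<omega> \<in> Z" using cell_less[OF \<omega>(1,2), of k] by (auto simp: Z_def)
      moreover have "\<omega> \<in> ?I k (cell k \<omega>)" using cell_eq_iff[OF \<omega>(1)] by blast
      ultimately show "\<omega> \<in> (\<Union>c\<in>Z. ?I k c)" by blast
    qed
    then have "prob S \<le> prob (\<Union>c\<in>Z. ?I k c)"
      using Z by (intro finite_measure_mono) auto
    also have "\<dots> \<le> (\<Sum>c\<in>Z. prob (?I k c))"
      using Z by (intro finite_measure_subadditive_finite) auto
    also have "\<dots> = card Z / P k"
      using measure_cell by (simp add: Z_def del: measure_uniform_measure)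
    also have "\<dots> \<le> 2 / P k" using card by (intro divide_right_mono) auto
    finally show ?thesis .
  qed
  obtain C :: real where C: "0 < C" "\<And>k. Q (Suc k) powr (1/2) \<le> C * P k"
    using growth[of "1/2"] by auto
  have "prob S \<le> 2 * C * (1 / sqrt 2) ^ k" for k
  proof -
    have "(2::real) ^ k \<le> 2 ^ Suc k" by simp
    also have "\<dots> \<le> real (Q (Suc k))" by (rule power_le_real_Q)
    finally have "sqrt 2 ^ k \<le> sqrt (real (Q (Suc k)))" by (simp flip: real_sqrt_power)
    also have "\<dots> \<le> C * P k" using C(2)[of k] by (simp add: powr_half_sqrt)
    finally have "2 / P k \<le> 2 * C * (1 / sqrt 2) ^ k"
      using P_pos[of k] by (simp add: field_simps power_divide)
    with le[of k] show ?thesis by linarith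
  qed
  moreover have "(\<lambda>k. 2 * C * (1 / sqrt 2) ^ k) \<longlonglongrightarrow> 2 * C * 0"
    by (intro tendsto_intros LIMSEQ_realpow_zero) auto
  ultimately have "prob S \<le> 2 * C * 0" using LIMSEQ_le_const by blast
  then have "prob S = 0" using measure_nonneg[of unit_uniform S] by linarith
  then have "AE \<omega> in unit_uniform. \<omega> \<notin> S" using S by (intro AE_not_in) (auto simp: null_sets_def emeasure_eq_measure simp del: emeasure_uniform_measure)
  moreover have "AE \<omega> in unit_uniform. 0 \<le> \<omega> \<and> \<omega> < 1" by (rule AE_unit_uniform) simp
  ultimately show ?thesis by eventually_elim (auto simp: S_def)
qed

text \<open>The floor condition can fail only when \<open>coded \<omega>\<close> is the right end
  point of its interval. These points are countably many, and \<open>AE_coded_neq\<close> discards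
  them.\<close>

lemma law_limit_set:
  assumes growth: "\<And>\<beta>. \<beta> < 1 \<Longrightarrow> \<exists>C::real. 0 < C \<and> (\<forall>k. Q (Suc k) powr \<beta> \<le> C * P k)"
  shows "emeasure law limit_set = 1"
proof -
  have "AE \<omega> in unit_uniform. \<forall>k n. coded \<omega> \<noteq> real n / Q k"
    using AE_coded_neq[OF growth] by (simp add: AE_all_countable)
  moreover have "AE \<omega> in unit_uniform. 0 \<le> \<omega> \<and> \<omega> < 1" by (rule AE_unit_uniform) simp
  ultimately have "AE \<omega> in unit_uniform. coded \<omega> \<in> limit_set"
  proof eventually_elim
    case (elim \<omega>)
    have *: "\<lfloor>real (Q k) * coded \<omega>\<rfloor> = int (J k (cell k \<omega>))" for k
    proof -
      have "coded \<omega> \<noteq> real (J k (cell k \<omega>) + 1) / Q k" using elim(1) by blast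
      moreover have "coded \<omega> \<le> real (J k (cell k \<omega>) + 1) / Q k" "real (J k (cell k \<omega>)) / Q k \<le> coded \<omega>"
        using coded_bounds(2,3)[of \<omega> k] elim(2) by (auto simp: approx_def add_divide_distrib)
      ultimately have "coded \<omega> < real (J k (cell k \<omega>) + 1) / Q k" "real (J k (cell k \<omega>)) / Q k \<le> coded \<omega>"
        by auto
      then show ?thesis using Q_pos[of k] by (simp add: floor_eq_iff field_simps)
    qed
    have "0 \<le> coded \<omega> \<and> coded \<omega> < 1"
      using *[of 0] by (simp add: J_0 Q_def floor_eq_iff)
    then show ?case unfolding limit_set_def using * cell_less[of \<omega>] elim(2) by blast
  qed
  then have "AE x in law. x \<in> limit_set"
    unfolding law_def using measurable_limit_set by (subst AE_distr_iff) auto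
  then show ?thesis
    using prob_space.emeasure_eq_1_AE[OF prob_space_law] measurable_limit_set sets_law by blast
qed

text \<open>The one measure \<open>law\<close> serves every exponent \<open>\<beta> < 1\<close>; the
  supremum is reached by letting \<open>\<beta>\<close> tend to 1.\<close>

lemma fourier_dim_limit_set:
  assumes growth: "\<And>\<beta>. \<beta> < 1 \<Longrightarrow> \<exists>C::real. 0 < C \<and> (\<forall>k. Q (Suc k) powr \<beta> \<le> C * P k)"
  shows "fourier_dim limit_set = 1"
proof (rule antisym)
  show "fourier_dim limit_set \<le> 1"
    unfolding fourier_dim_def by (rule Sup_least) (auto simp: one_ereal_def)
  have supp: "supported_prob_measure limit_set law"
    using prob_space_law sets_law law_limit_set[OF growth] by (simp add: supported_prob_measure_def)
  interpret law: real_distribution law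
    using prob_space_law sets_law by (simp add: real_distribution_def real_distribution_axioms_def)
  have "ereal \<beta> \<le> fourier_dim limit_set" if \<beta>: "0 \<le> \<beta>" "\<beta> < 1" for \<beta>
  proof -
    obtain C where C: "0 < C"
      "\<And>k \<xi>. \<xi> \<noteq> 0 \<Longrightarrow> cmod (trig_mean k \<xi> * unif_char (\<xi> / Q k)) \<le> C * \<bar>\<xi>\<bar> powr (- \<beta> / 2)"
      using trig_mean_decay[OF growth \<beta>] by blast
    \<comment> \<open>The power of 2 replaces \<open>1 + \<bar>\<xi>\<bar>\<close> by its half,
      which is at most \<open>\<bar>\<xi>\<bar>\<close> when
      \<open>1 \<le> \<bar>\<xi>\<bar>\<close> and at most 1 otherwise. The summand 1 in
      \<open>C + 1\<close> covers the second case by the trivial bound.\<close>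
    define D where "D = (C + 1) * 2 powr (\<beta> / 2)"
    have D: "0 < D" using C by (simp add: D_def)
    have "cmod (fourier_transform law \<xi>) \<le> D * (1 + \<bar>\<xi>\<bar>) powr (- \<beta> / 2)" for \<xi>
    proof -
      have eq: "D * (1 + \<bar>\<xi>\<bar>) powr (- \<beta> / 2) = (C + 1) * ((1 + \<bar>\<xi>\<bar>) / 2) powr (- \<beta> / 2)"
        by (simp add: D_def powr_divide powr_minus field_simps)
      show ?thesis
      proof (cases "1 \<le> \<bar>\<xi>\<bar>")
        case True
        have "cmod (fourier_transform law \<xi>) \<le> C * \<bar>- \<xi>\<bar> powr (- \<beta> / 2)"
          unfolding fourier_transform_eq_char using True by (intro cmod_char_law_le C) auto
        also have "\<dots> \<le> (C + 1) * ((1 + \<bar>\<xi>\<bar>) / 2) powr (- \<beta> / 2)"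
          using True C \<beta> by (intro mult_mono powr_mono2') auto
        finally show ?thesis using eq by simp
      next
        case False
        have "1 \<le> ((1 + \<bar>\<xi>\<bar>) / 2) powr (- \<beta> / 2)"
          using False \<beta> powr_mono2'[of "- \<beta> / 2" "(1 + \<bar>\<xi>\<bar>) / 2" 1] by auto
        then have "1 * 1 \<le> (C + 1) * ((1 + \<bar>\<xi>\<bar>) / 2) powr (- \<beta> / 2)"
          using C by (intro mult_mono) auto
        then show ?thesis using law.cmod_char_le_1[of "- \<xi>"] eq by (simp add: fourier_transform_eq_char)
      qed
    qed
    then show ?thesis unfolding fourier_dim_def using supp D \<beta> by (intro Sup_upper) auto
  qed
  then have "\<beta> \<le> fourier_dim limit_set" if "0 < \<beta>" "\<beta> < 1" for \<beta>
    using that by (cases \<beta>) (auto simp: one_ereal_def zero_ereal_def)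
  then show "1 \<le> fourier_dim limit_set" by (rule dense_le_bounded[of 0, rotated]) simp_all
qed

section \<open>Absence of solutions in the limit set\<close>

lemma limit_set_digit:
  fixes x :: real
  assumes "x \<in> limit_set"
  obtains c r where "c < P k" "r < m k" "\<lfloor>Q k * x\<rfloor> = int (J k c)"
    "\<lfloor>Q (Suc k) * x\<rfloor> = int (N k * J k c + (A k r + s k c) mod N k)"
proof -
  have "\<forall>k. \<exists>c<P k. \<lfloor>real (Q k) * x\<rfloor> = int (J k c)" using assms by (simp add: limit_set_def)
  from spec[OF this, of "Suc k"] obtain c
    where c: "c < P (Suc k)" "\<lfloor>Q (Suc k) * x\<rfloor> = int (J (Suc k) c)" by blast
  \<comment> \<open>Membership provides an interval at each level separately; division by
    \<open>N k\<close> shows that the one of level \<open>Suc k\<close> descends from the one of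
    level \<open>k\<close>.\<close>
  have "\<lfloor>Q k * x\<rfloor> = \<lfloor>(Q (Suc k) * x) / real_of_int (int (N k))\<rfloor>"
    using N_pos[of k] by (simp add: Q_Suc)
  also have "\<dots> = \<lfloor>Q (Suc k) * x\<rfloor> div int (N k)" by (rule floor_divide_real_eq_div) simp
  also have "\<dots> = int (J k (c div m k))" by (simp only: c(2) J_Suc_div_mod(1) flip: zdiv_int)
  finally show thesis
    using that[of "c div m k" "c mod m k"] c m_pos[of k]
    by (simp add: J_Suc P_Suc less_mult_imp_div_less)
qed

text \<open>By induction the three points share their interval at every level. The next digits
  satisfy the equation up to less than 1, from the fractional parts, and replacing \<open>t\<close>
  by \<open>p / M\<close> costs at most 1 more. Multiplied by \<open>M\<close> this stays below
  \<open>2 * M\<close>, the error in \<open>avoiding_digits\<close>. The fraction may vary with the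
  level.\<close>

lemma limit_set_no_solution:
  fixes t x y z :: real
  assumes digits: "\<And>k. \<exists>M p. avoiding_digits M (N k) (A k ` {..<m k}) \<and> 0 < p \<and> p < M \<and>
      \<bar>t - real p / real M\<bar> * real (N k) \<le> 1"
    and t: "0 < t" "t < 1" and xyz: "x \<in> limit_set" "y \<in> limit_set" "z \<in> limit_set"
    and eq: "t * x + (1 - t) * y = z"
  shows "x = y"
proof -
  have same: "\<lfloor>Q k * x\<rfloor> = \<lfloor>Q k * y\<rfloor> \<and> \<lfloor>Q k * y\<rfloor> = \<lfloor>Q k * z\<rfloor>" for k
  proof (induction k)
    case 0
    have "\<lfloor>Q 0 * v\<rfloor> = 0" if "v \<in> limit_set" for v :: real
      using that by (auto simp: limit_set_def Q_def floor_eq_iff)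
    then show ?case using xyz by simp
  next
    case (Suc k)
    obtain c a where x: "c < P k" "a < m k" "\<lfloor>Q k * x\<rfloor> = int (J k c)"
      "\<lfloor>Q (Suc k) * x\<rfloor> = int (N k * J k c + (A k a + s k c) mod N k)"
      using limit_set_digit[OF xyz(1)] .
    obtain c' b where y: "c' < P k" "b < m k" "\<lfloor>Q k * y\<rfloor> = int (J k c')"
      "\<lfloor>Q (Suc k) * y\<rfloor> = int (N k * J k c' + (A k b + s k c') mod N k)"
      using limit_set_digit[OF xyz(2)] .
    obtain c'' d where z: "c'' < P k" "d < m k" "\<lfloor>Q k * z\<rfloor> = int (J k c'')"
      "\<lfloor>Q (Suc k) * z\<rfloor> = int (N k * J k c'' + (A k d + s k c'') mod N k)"
      using limit_set_digit[OF xyz(3)] .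
    \<comment> \<open>The same interval means the same shift \<open>s k c\<close> for all three
      points.\<close>
    have [simp]: "c' = c" "c'' = c"
      using Suc x(1,3) y(1,3) z(1,3) inj_onD[OF J_inj[of k]] by auto
    obtain M p where A: "avoiding_digits M (N k) (A k ` {..<m k})" and p: "0 < p" "p < M"
      and t_near: "\<bar>t - real p / real M\<bar> * real (N k) \<le> 1" using digits by blast
    define dig where "dig r = (A k r + s k c) mod N k" for r
    have dig_less: "dig r < N k" for r using N_pos by (simp add: dig_def)
    define u v w where "u = Q (Suc k) * x - real (N k * J k c + dig a)"
      and "v = Q (Suc k) * y - real (N k * J k c + dig b)"
      and "w = Q (Suc k) * z - real (N k * J k c + dig d)"
    have uvw: "0 \<le> u" "u < 1" "0 \<le> v" "v < 1" "0 \<le> w" "w < 1"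
      using x(4) y(4) z(4) unfolding u_def v_def w_def dig_def by (simp_all add: floor_eq_iff)
    have "t * u + (1 - t) * v - w
      = Q (Suc k) * (t * x + (1 - t) * y - z) - (t * dig a + (1 - t) * dig b - dig d)"
      by (simp add: u_def v_def w_def algebra_simps)
    then have frac: "t * real (dig a) + (1 - t) * real (dig b) - real (dig d) = w - (t * u + (1 - t) * v)"
      using eq by simp
    have "0 \<le> t * u + (1 - t) * v" using t uvw by simp
    moreover have "t * u + (1 - t) * v < 1"
      by (rule convex_bound_lt) (use t uvw in auto)
    ultimately have 1: "\<bar>t * real (dig a) + (1 - t) * real (dig b) - real (dig d)\<bar> < 1"
      unfolding frac using uvw by linarith
    define \<tau> where "\<tau> = real p / real M"
    have M: "0 < real M" and \<tau>: "\<tau> * real M = real p" using p by (auto simp: \<tau>_def)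
    have "\<bar>real (dig b) - real (dig a)\<bar> \<le> N k"
      using dig_less[of a] dig_less[of b] by linarith
    then have "\<bar>(t - \<tau>) * (real (dig b) - real (dig a))\<bar> \<le> \<bar>t - \<tau>\<bar> * N k"
      unfolding abs_mult by (intro mult_left_mono) auto
    with t_near have 2: "\<bar>(t - \<tau>) * (real (dig b) - real (dig a))\<bar> \<le> 1" by (simp add: \<tau>_def)
    have "\<tau> * real (dig a) + (1 - \<tau>) * real (dig b) - real (dig d)
      = (t * real (dig a) + (1 - t) * real (dig b) - real (dig d)) + (t - \<tau>) * (real (dig b) - real (dig a))"
      by (simp add: algebra_simps)
    with 1 2 have "\<bar>\<tau> * real (dig a) + (1 - \<tau>) * real (dig b) - real (dig d)\<bar> < 2" by linarith
    then have "real M * \<bar>\<tau> * real (dig a) + (1 - \<tau>) * real (dig b) - real (dig d)\<bar> < real M * 2"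
      using M by (intro mult_strict_left_mono)
    also have "real M * \<bar>\<tau> * real (dig a) + (1 - \<tau>) * real (dig b) - real (dig d)\<bar>
      = \<bar>real M * (\<tau> * real (dig a) + (1 - \<tau>) * real (dig b) - real (dig d))\<bar>" by (simp add: abs_mult)
    also have "real M * (\<tau> * real (dig a) + (1 - \<tau>) * real (dig b) - real (dig d))
      = (\<tau> * real M) * real (dig a) + (real M - \<tau> * real M) * real (dig b) - real M * real (dig d)"
      by (simp add: algebra_simps)
    also have "\<dots> = of_int (int p * int (dig a) + (int M - int p) * int (dig b) - int M * int (dig d))"
      unfolding \<tau> by simp
    finally have 3: "\<bar>int p * int (dig a) + (int M - int p) * int (dig b) - int M * int (dig d)\<bar> < 2 * int M"
      by linarith
    \<comment> \<open>\<open>W r\<close> counts how often the shifted digit wraps around. The shift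
      itself cancels because the coefficients \<open>p\<close>, \<open>M - p\<close> and
      \<open>- M\<close> add up to 0, so only a multiple of \<open>N k\<close> remains.\<close>
    define W where "W r = int ((A k r + s k c) div N k)" for r
    have dig: "int (dig r) = int (A k r) + int (s k c) - int (N k) * W r" for r
    proof -
      have "int (N k * ((A k r + s k c) div N k) + dig r) = int (A k r + s k c)"
        unfolding dig_def by (simp only: mult_div_mod_eq)
      then show ?thesis by (simp add: W_def)
    qed
    have "int p * int (dig a) + (int M - int p) * int (dig b) - int M * int (dig d)
      = int p * int (A k a) + (int M - int p) * int (A k b) - int M * int (A k d)
        + int (N k) * (int M * W d - int p * W a - (int M - int p) * W b)"
      unfolding dig by (simp add: algebra_simps)
    then have "A k a = A k b \<and> A k b = A k d"
      using A 3 p x(2) y(2) z(2) unfolding avoiding_digits_def by (metis imageI lessThan_iff)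
    then show ?case using x(4) y(4) z(4) by simp
  qed
  have "\<bar>x - y\<bar> \<le> (1 / 2) ^ k" for k
  proof -
    have "\<bar>Q k * x - Q k * y\<bar> \<le> 1" using same[of k] by linarith
    then have "\<bar>real (Q k) * (x - y)\<bar> \<le> 1" by (simp add: right_diff_distrib)
    then have "real (Q k) * \<bar>x - y\<bar> \<le> 1" by (simp add: abs_mult)
    moreover have "2 ^ k * \<bar>x - y\<bar> \<le> real (Q k) * \<bar>x - y\<bar>"
      using power_le_real_Q[of k] by (intro mult_right_mono) auto
    ultimately show ?thesis by (simp add: power_divide field_simps)
  qed
  moreover have "(\<lambda>k. (1 / 2) ^ k :: real) \<longlonglongrightarrow> 0" by (rule LIMSEQ_realpow_zero) auto
  ultimately have "\<bar>x - y\<bar> \<le> 0" using LIMSEQ_le_const by blast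
  then show "x = y" by simp
qed

end

section \<open>Growth of the digit system\<close>

text \<open>Take the largest \<open>i \<le> k\<close> with \<open>N i \<le> k + N 0\<close>: every
  fixed index qualifies eventually, and the summand \<open>N 0\<close> makes index 0 always
  available.\<close>

lemma exists_slow_index:
  fixes N :: "nat \<Rightarrow> nat"
  obtains j :: "nat \<Rightarrow> nat" where "\<And>r. \<forall>\<^sub>F k in sequentially. r \<le> j k" "\<And>k. N (j k) \<le> k + N 0"
proof -
  define S where "S k = {i. i \<le> k \<and> N i \<le> k + N 0}" for k
  have S: "finite (S k)" "0 \<in> S k" for k by (auto simp: S_def)
  show thesis
  proof (rule that[of "\<lambda>k. Max (S k)"])
    have "Max (S k) \<in> S k" for k using Max_in[of "S k"] S[of k] by blast
    then show "N (Max (S k)) \<le> k + N 0" for k unfolding S_def by blast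
    show "\<forall>\<^sub>F k in sequentially. r \<le> Max (S k)" for r
      using eventually_ge_at_top[of "max r (N r)"]
    proof eventually_elim
      case (elim k)
      then have "r \<in> S k" by (simp add: S_def)
      then show ?case using S by simp
    qed
  qed
qed

context digit_system
begin

text \<open>From some level on \<open>N k powr \<gamma> \<le> m k\<close>, which multiplies up to a
  bound of \<open>Q k powr \<gamma>\<close> by a multiple of \<open>P k\<close>. The extra factor
  \<open>N k\<close> in \<open>Q (Suc k)\<close> is at most linear in \<open>k\<close> and is
  absorbed by a small power of \<open>Q k \<ge> 2 ^ k\<close>.\<close>

lemma growth_from_density:
  assumes dense: "\<And>r. \<forall>\<^sub>F k in sequentially. N k ^ r \<le> m k ^ Suc r" and slow: "\<And>k. N k \<le> k + n"
    and \<beta>: "\<beta> < 1"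
  shows "\<exists>C::real. 0 < C \<and> (\<forall>k. Q (Suc k) powr \<beta> \<le> C * P k)"
proof -
  \<comment> \<open>Negative \<open>\<beta>\<close> is raised to 0 for monotonicity;
    \<open>\<gamma>\<close> lies halfway between \<open>b\<close> and 1, which leaves
    \<open>\<delta>\<close> for the factor \<open>N k\<close>.\<close>
  define b where "b = max \<beta> 0"
  define \<gamma> where "\<gamma> = (b + 1) / 2"
  define \<delta> where "\<delta> = \<gamma> - b"
  have b: "0 \<le> b" "b \<le> 1" "\<beta> \<le> b" and \<gamma>: "0 < \<gamma>" "\<gamma> < 1" and \<delta>: "0 < \<delta>"
    using \<beta> by (auto simp: b_def \<gamma>_def \<delta>_def field_simps)
  obtain r :: nat where r: "1 / (1 - \<gamma>) \<le> real r" using real_arch_simple by blast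
  then have r1: "\<gamma> * real (Suc r) \<le> real r" using \<gamma> by (simp add: field_simps)
  obtain k0 where k0: "\<And>k. k0 \<le> k \<Longrightarrow> N k ^ r \<le> m k ^ Suc r"
    using dense[of r] unfolding eventually_sequentially by blast
  have m_ge: "N k powr \<gamma> \<le> m k" if "k0 \<le> k" for k
  proof -
    have "(N k powr \<gamma>) ^ Suc r = N k powr (\<gamma> * real (Suc r))"
      using N_pos[of k] by (simp only: powr_power) (simp add: mult.commute)
    also have "\<dots> \<le> N k powr real r" using N_ge2[of k] r1 by (intro powr_mono) auto
    also have "\<dots> = real (N k ^ r)" using N_pos[of k] by (simp add: powr_realpow)
    also have "\<dots> \<le> real (m k ^ Suc r)" using k0[OF that] by (simp only: of_nat_le_iff)
    finally have "(N k powr \<gamma>) ^ Suc r \<le> real (m k) ^ Suc r" by simp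
    then show ?thesis by (rule power_le_imp_le_base) simp
  qed
  define K where "K = real (Q k0) powr \<gamma>"
  have K: "0 < K" using Q_pos[of k0] by (simp add: K_def)
  have QP: "Q k powr \<gamma> \<le> K * P k" if "k0 \<le> k" for k
    using that
  proof (induction k rule: dec_induct)
    case base
    have "K * 1 \<le> K * P k0" using K P_pos[of k0] by (intro mult_left_mono) auto
    then show ?case by (simp add: K_def)
  next
    case (step k)
    have "Q (Suc k) powr \<gamma> = N k powr \<gamma> * Q k powr \<gamma>" by (simp add: Q_Suc powr_mult)
    also have "\<dots> \<le> m k * (K * P k)" using step m_ge[of k] by (intro mult_mono) auto
    finally show ?case by (simp add: P_Suc mult_ac)
  qed
  define L where "L = 1 / (\<delta> * ln 2) + real n"
  have L: "0 \<le> L" using \<delta> by (simp add: L_def)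
  have slow': "real (k + n) \<le> L * Q k powr \<delta>" for k
  proof -
    have 1: "1 + k * (\<delta> * ln 2) \<le> Q k powr \<delta>"
    proof -
      have "1 + k * (\<delta> * ln 2) \<le> exp (k * (\<delta> * ln 2))" by (rule exp_ge_add_one_self)
      also have "\<dots> = (2 ^ k) powr \<delta>" by (simp add: powr_def ln_realpow mult_ac)
      also have "\<dots> \<le> Q k powr \<delta>" using power_le_real_Q[of k] \<delta> by (intro powr_mono2) auto
      finally show ?thesis .
    qed
    have c: "0 < \<delta> * ln 2" using \<delta> by simp
    have "real (k + n) \<le> 1 / (\<delta> * ln 2) * (1 + k * (\<delta> * ln 2)) + n * (1 + k * (\<delta> * ln 2))"
    proof (rule order.trans[of _ "real k + real n * 1"])
      have "real k \<le> 1 / (\<delta> * ln 2) * (1 + k * (\<delta> * ln 2))" using c by (simp add: field_simps)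
      moreover have "real n * 1 \<le> n * (1 + k * (\<delta> * ln 2))" using c by (intro mult_left_mono) auto
      ultimately show "real k + real n * 1 \<le> 1 / (\<delta> * ln 2) * (1 + k * (\<delta> * ln 2)) + n * (1 + k * (\<delta> * ln 2))"
        by (rule add_mono)
    qed simp
    also have "\<dots> = L * (1 + k * (\<delta> * ln 2))" by (simp add: L_def algebra_simps)
    also have "\<dots> \<le> L * Q k powr \<delta>" using 1 L by (rule mult_left_mono)
    finally show ?thesis .
  qed
  have "Q (Suc k) powr \<beta> / P k \<le> L * K" if "k0 \<le> k" for k
  proof -
    have "N k powr b \<le> N k powr 1" using N_pos[of k] b by (intro powr_mono) auto
    also have "\<dots> \<le> real (k + n)" using slow[of k] by simp
    also note slow'
    finally have Nb: "N k powr b \<le> L * Q k powr \<delta>" .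
    have "Q (Suc k) powr \<beta> \<le> Q (Suc k) powr b"
      using Q_Suc_ge2[of k] b by (intro powr_mono) auto
    also have "\<dots> = N k powr b * Q k powr b" by (simp add: Q_Suc powr_mult)
    also have "\<dots> \<le> L * Q k powr \<delta> * Q k powr b" using Nb by (rule mult_right_mono) simp
    also have "L * Q k powr \<delta> * Q k powr b = L * Q k powr \<gamma>"
      by (simp add: \<delta>_def flip: powr_add)
    also have "\<dots> \<le> L * (K * P k)" using QP[OF that] L by (rule mult_left_mono)
    finally show ?thesis using P_pos[of k] by (simp add: field_simps)
  qed
  \<comment> \<open>The finitely many levels before \<open>k0\<close> only change the
    constant.\<close>
  then have "eventually (\<lambda>k. norm (Q (Suc k) powr \<beta> / P k) \<le> L * K) sequentially"
    unfolding eventually_sequentially by (intro exI[of _ k0]) auto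
  then have "Bseq (\<lambda>k. Q (Suc k) powr \<beta> / P k)" by (rule BfunI)
  then obtain C where C: "0 < C" "\<And>k. norm (Q (Suc k) powr \<beta> / P k) \<le> C" unfolding Bseq_def by blast
  have "Q (Suc k) powr \<beta> \<le> C * P k" for k
    using C(2)[of k] P_pos[of k] by (simp add: field_simps)
  with C(1) show ?thesis by blast
qed

end

section \<open>The coefficients\<close>

text \<open>Truncating the series before term \<open>i\<close> gives a fraction with denominator
  \<open>M i\<close>, since each \<open>M l\<close> divides the next, and the tail is at most
  \<open>2 / M (Suc i) = 1 / (2 * M i * N i)\<close>. Sets with one element give rationals; the
  values for all sets are uncountably many, so removing the rationals leaves uncountably
  many.\<close>

lemma approximable_coefficients:
  fixes M N :: "nat \<Rightarrow> nat"
  assumes M_0: "M 0 = 4" and M_Suc: "\<And>i. M (Suc i) = 4 * M i * N i" and N: "\<And>i. 2 \<le> N i"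
  obtains T :: "real set" where "T \<subseteq> {0<..<1}" "infinite (T \<inter> \<rat>)" "uncountable (T - \<rat>)"
    "\<And>t i. t \<in> T \<Longrightarrow> \<exists>p. 0 < p \<and> p < M i \<and> \<bar>t - real p / real (M i)\<bar> * real (N i) \<le> 1"
proof -
  have N0: "0 < N i" for i using N[of i] by simp
  have M_pos: "0 < M i" for i by (induction i) (auto simp: M_0 M_Suc N0)
  have M_growth: "8 * real (M i) \<le> real (M (Suc i))" for i
  proof -
    have "8 * M i \<le> M (Suc i)" using mult_le_mono2[OF N[of i], of "4 * M i"] by (simp add: M_Suc)
    from of_nat_mono[OF this, where ?'a = real] show ?thesis by simp
  qed
  have M_dvd: "M i dvd M l" if "i \<le> l" for i l
    using that by (induction l rule: dec_induct) (auto simp: M_Suc dvd_mult dvd_mult2 intro: dvd_trans)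
  define e where "e l = 1 / real (M (Suc l))" for l
  have e: "0 < e l" "4 * e (Suc l) \<le> e l" for l
    using M_pos[of "Suc l"] M_pos[of "Suc (Suc l)"] M_growth[of "Suc l"] by (auto simp: e_def field_simps)
  have e0: "e 0 \<le> 1 / 32"
    using M_growth[of 0] by (simp add: e_def M_0 field_simps)
  have e_sum: "(\<Sum>l<n. e (i + l)) \<le> 2 * e i" for n i
  proof (induction n arbitrary: i)
    case (Suc n)
    have "(\<Sum>l<Suc n. e (i + l)) = e i + (\<Sum>l<n. e (Suc i + l))"
      by (simp add: sum.lessThan_Suc_shift del: sum.lessThan_Suc)
    also have "\<dots> \<le> e i + 2 * e (Suc i)" using Suc.IH[of "Suc i"] by simp
    finally show ?case using e[of i] by linarith
  qed (use e(1) in \<open>simp add: less_imp_le\<close>)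
  define g where "g S l = (if l \<in> S then e l else 0)" for S l
  have g: "0 \<le> g S l" "g S l \<le> e l" for S l using e[of l] by (auto simp: g_def less_imp_le)
  have part: "(\<Sum>l<n. g S (l + i)) \<le> 2 * e i" for S n i
    using sum_mono[of "{..<n}" "\<lambda>l. g S (l + i)" "\<lambda>l. e (i + l)"] g(2) e_sum[of i n]
    by (fastforce simp: add.commute)
  have sums: "summable (\<lambda>l. g S (l + i))" for S i
    using g part by (intro summableI_nonneg_bounded[where x = "2 * e i"]) auto
  define tail where "tail S i = (\<Sum>l. g S (l + i))" for S i
  have tail: "0 \<le> tail S i" "tail S i \<le> 2 * e i" for S i
    unfolding tail_def using suminf_nonneg[OF sums] suminf_le_const[OF sums] g part by auto
  define \<tau> where "\<tau> S = 1 / 4 + tail S 0" for S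
  have \<tau>: "\<tau> S = 1 / 4 + (\<Sum>l<i. g S l) + tail S i" for S i
    using suminf_split_initial_segment[OF sums[of S 0], of i] by (simp add: \<tau>_def tail_def)
  have range01: "0 < \<tau> S" "\<tau> S < 1" for S using tail[of S 0] e0 by (auto simp: \<tau>_def)
  \<comment> \<open>At the first difference the term \<open>e i\<close> outweighs the remaining
    tail, which is at most \<open>2 * e (Suc i) \<le> e i / 2\<close>.\<close>
  have less: "\<tau> S' < \<tau> S" if "i \<in> S" "i \<notin> S'" "\<And>l. l < i \<Longrightarrow> l \<in> S \<longleftrightarrow> l \<in> S'" for S S' i
  proof -
    have "(\<Sum>l<i. g S l) = (\<Sum>l<i. g S' l)" using that by (intro sum.cong) (auto simp: g_def)
    moreover have "g S i = e i" "g S' i = 0" using that by (auto simp: g_def)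
    ultimately show ?thesis
      using \<tau>[of S "Suc i"] \<tau>[of S' "Suc i"] tail[of S "Suc i"] tail[of S' "Suc i"] e[of i] by simp
  qed
  have inj: "inj \<tau>"
  proof (rule injI, rule ccontr)
    fix S S' assume eq: "\<tau> S = \<tau> S'" and "S \<noteq> S'"
    then have ex: "\<exists>i. \<not> (i \<in> S \<longleftrightarrow> i \<in> S')" by blast
    define i where "i = (LEAST i. \<not> (i \<in> S \<longleftrightarrow> i \<in> S'))"
    have "\<not> (i \<in> S \<longleftrightarrow> i \<in> S')" "\<And>l. l < i \<Longrightarrow> l \<in> S \<longleftrightarrow> l \<in> S'"
      unfolding i_def using LeastI_ex[OF ex] not_less_Least by blast+
    then show False using less[of i S S'] less[of i S' S] eq by auto
  qed
  have uncountable_nat_sets: "uncountable (UNIV :: nat set set)"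
  proof
    assume "countable (UNIV :: nat set set)"
    then have "range (from_nat_into (UNIV :: nat set set)) = Pow UNIV" by (simp add: range_from_nat_into)
    then show False using Cantors_theorem by blast
  qed
  show thesis
  proof (rule that[of "range \<tau>"])
    show "range \<tau> \<subseteq> {0<..<1}" using range01 by auto
    have "uncountable (range \<tau>)" using uncountable_nat_sets countable_image_inj_on[OF _ inj] by blast
    then show "uncountable (range \<tau> - \<rat>)" by (rule uncountable_minus_countable) (rule countable_rat)
    have "inj (\<lambda>n. \<tau> {n})" using inj by (auto simp: inj_def)
    then have "infinite (range (\<lambda>n. \<tau> {n}))" by (rule range_inj_infinite)
    moreover have "range (\<lambda>n. \<tau> {n}) \<subseteq> range \<tau> \<inter> \<rat>"
    proof -
      have "\<tau> {n} \<in> \<rat>" for n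
      proof -
        have "tail {n} (Suc n) = 0" by (simp add: tail_def g_def)
        moreover have "(\<Sum>l<Suc n. g {n} l) = e n" by (simp add: g_def del: sum.lessThan_Suc)
        ultimately show ?thesis using \<tau>[of "{n}" "Suc n"] by (simp add: e_def del: sum.lessThan_Suc)
      qed
      then show ?thesis by auto
    qed
    ultimately show "infinite (range \<tau> \<inter> \<rat>)" using infinite_super by blast
    fix t i assume "t \<in> range \<tau>"
    then obtain S where t: "t = \<tau> S" by auto
    \<comment> \<open>Numerator of the truncated sum over the denominator \<open>M i\<close>; the
      divisions are exact. The summand \<open>1/4\<close> keeps it positive for every
      \<open>S\<close>.\<close>
    define p where "p = M i div 4 + (\<Sum>l<i. if l \<in> S then M i div M (Suc l) else 0)"
    have "real p / M i = 1 / 4 + (\<Sum>l<i. g S l)"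
    proof -
      have "real (M i div 4) / M i = 1 / 4"
        using M_dvd[of 0 i] M_pos[of i] by (simp add: M_0 real_of_nat_div)
      moreover have "real (if l \<in> S then M i div M (Suc l) else 0) / M i = g S l" if "l < i" for l
        using M_dvd[of "Suc l" i] M_pos[of i] that by (simp add: g_def e_def real_of_nat_div)
      ultimately show ?thesis by (simp add: p_def add_divide_distrib sum_divide_distrib)
    qed
    then have p: "t = real p / M i + tail S i" "1 / 4 \<le> real p / M i"
      using \<tau>[of S i] t g(1) by (auto intro!: sum_nonneg)
    have "real p / M i < 1" using p(1) range01[of S] tail[of S i] t by linarith
    then have "p < M i" using M_pos[of i] by simp
    moreover have "0 < p" using p(2) by (cases "p = 0") auto
    moreover have "\<bar>t - real p / M i\<bar> * N i \<le> 2 * e i * N i"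
      using p(1) tail[of S i] by (intro mult_right_mono) auto
    moreover have "2 * e i * N i \<le> 1"
      using M_pos[of i] N0[of i] by (simp add: e_def M_Suc field_simps)
    ultimately show "\<exists>p. 0 < p \<and> p < M i \<and> \<bar>t - real p / real (M i)\<bar> * real (N i) \<le> 1" by (meson order.trans)
  qed
qed

section \<open>Combining the digit sets, the levels and the coefficients\<close>

theorem theorem1p10:
  "\<exists>(T :: real set) (E :: real set).
     infinite T \<and> T \<subseteq> {0<..<1} \<and>
     infinite (T \<inter> \<rat>) \<and> uncountable (T - \<rat>) \<and>
     E \<in> sets borel \<and> E \<subseteq> {0..1} \<and> fourier_dim E = 1 \<and>
     (\<forall>t\<in>T. \<not> (\<exists>x\<in>E. \<exists>y\<in>E. \<exists>z\<in>E. nontrivial_solution t x y z))"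
proof -
  have "\<forall>M r. \<exists>N A. 0 < M \<longrightarrow> 2 \<le> N \<and> A \<subseteq> {..<N} \<and> avoiding_digits M N A \<and> N ^ r \<le> card A ^ Suc r"
    using dense_avoiding_digits[of _ "Suc _"] by (metis diff_Suc_1 zero_less_Suc)
  then obtain F B where FB: "\<And>M r. 0 < M \<Longrightarrow> 2 \<le> F M r" "\<And>M r. 0 < M \<Longrightarrow> B M r \<subseteq> {..<F M r}"
    "\<And>M r. 0 < M \<Longrightarrow> avoiding_digits M (F M r) (B M r)"
    "\<And>M r. 0 < M \<Longrightarrow> F M r ^ r \<le> card (B M r) ^ Suc r"
    by metis
  \<comment> \<open>\<open>K i\<close> is the radix found for \<open>M i\<close>, with density
    exponent \<open>i / (i + 1)\<close>; \<open>M (Suc i)\<close> is then formed from both as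
    \<open>approximable_coefficients\<close> demands.\<close>
  define M where "M = rec_nat 4 (\<lambda>i x. 4 * x * F x i)"
  define K where "K i = F (M i) i" for i
  define D where "D i = B (M i) i" for i
  have M: "M 0 = 4" "M (Suc i) = 4 * M i * K i" for i by (simp_all add: M_def K_def)
  have M_pos: "0 < M i" for i
  proof (induction i)
    case (Suc i)
    then show ?case using FB(1)[OF Suc, of i] by (simp add: M K_def)
  qed (simp add: M)
  have K: "2 \<le> K i" and D: "D i \<subseteq> {..<K i}" "avoiding_digits (M i) (K i) (D i)" "K i ^ i \<le> card (D i) ^ Suc i" for i
    using FB[OF M_pos[of i]] by (simp_all add: K_def D_def)
  obtain T where T: "T \<subseteq> {0<..<1}" "infinite (T \<inter> \<rat>)" "uncountable (T - \<rat>)"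
    "\<And>t i. t \<in> T \<Longrightarrow> \<exists>p. 0 < p \<and> p < M i \<and> \<bar>t - real p / real (M i)\<bar> * real (K i) \<le> 1"
    using approximable_coefficients[OF M K] by blast
  obtain j where j: "\<And>r. \<forall>\<^sub>F k in sequentially. r \<le> j k" "\<And>k. K (j k) \<le> k + K 0"
    using exists_slow_index[of K] by blast
  \<comment> \<open>Level \<open>k\<close> uses the radix and digits of index \<open>j k\<close>, so
    \<open>N k\<close> is at most linear in \<open>k\<close> while the density exponent still tends
    to 1.\<close>
  define N where "N k = K (j k)" for k
  define m where "m k = card (D (j k))" for k
  have "\<forall>k. \<exists>h. bij_betw h {..<m k} (D (j k))"
    using ex_bij_betw_nat_finite finite_subset[OF D(1)] by (metis m_def lessThan_atLeast0 finite_lessThan)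
  then obtain A where A: "\<And>k. bij_betw (A k) {..<m k} (D (j k))" by metis
  have A_image: "A k ` {..<m k} = D (j k)" for k using A by (rule bij_betw_imp_surj_on)
  interpret digit_system N m A
  proof
    show "2 \<le> N k" for k using K by (simp add: N_def)
    show "0 < m k" for k
      using D(3)[of "j k"] K[of "j k"] by (cases "m k = 0") (auto simp: m_def)
    show "inj_on (A k) {..<m k}" for k using A by (rule bij_betw_imp_inj_on)
    show "A k r < N k" if "r < m k" for k r
      using A_image[of k] D(1)[of "j k"] that by (auto simp: N_def)
  qed
  have growth: "\<exists>C::real. 0 < C \<and> (\<forall>k. Q (Suc k) powr \<beta> \<le> C * P k)" if "\<beta> < 1" for \<beta>
  proof (rule growth_from_density[OF _ _ that])
    show "N k \<le> k + K 0" for k using j(2) by (simp add: N_def)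
    show "\<forall>\<^sub>F k in sequentially. N k ^ r \<le> m k ^ Suc r" for r
      using j(1)[of r]
    proof eventually_elim
      case (elim k)
      \<comment> \<open>Both sides are compared after raising them to the power
        \<open>Suc (j k)\<close>; since \<open>r \<le> j k\<close>, the exponent
        \<open>r * Suc (j k)\<close> is at most \<open>j k * Suc r\<close>.\<close>
      have "(N k ^ r) ^ Suc (j k) \<le> N k ^ (j k * Suc r)"
        unfolding power_mult[symmetric] using elim K[of "j k"] by (intro power_increasing) (auto simp: N_def)
      also have "\<dots> = (K (j k) ^ j k) ^ Suc r" by (simp only: power_mult N_def)
      also have "\<dots> \<le> (m k ^ Suc (j k)) ^ Suc r" unfolding m_def by (rule power_mono[OF D(3)]) simp
      also have "\<dots> = (m k ^ Suc r) ^ Suc (j k)" by (simp only: mult.commute flip: power_mult)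
      finally show ?case by (rule power_le_imp_le_base) simp
    qed
  qed
  obtain J s where "shifted_digits N m A J s" by (rule exists_shifted_digits)
  then interpret shifted_digits N m A J s .
  show ?thesis
  proof (intro exI conjI ballI)
    show "infinite T" using T(2) by blast
    show "T \<subseteq> {0<..<1}" "infinite (T \<inter> \<rat>)" "uncountable (T - \<rat>)" by fact+
    show "limit_set \<in> sets borel" by (rule measurable_limit_set)
    show "limit_set \<subseteq> {0..1}" by (auto simp: limit_set_def)
    show "fourier_dim limit_set = 1" by (rule fourier_dim_limit_set[OF growth])
    fix t assume t: "t \<in> T"
    have "x = y" if "x \<in> limit_set" "y \<in> limit_set" "z \<in> limit_set" "t * x + (1 - t) * y = z" for x y z
    proof (rule limit_set_no_solution[OF _ _ _ that])
      show "\<exists>M p. avoiding_digits M (N k) (A k ` {..<m k}) \<and> 0 < p \<and> p < M \<and>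
          \<bar>t - real p / real M\<bar> * real (N k) \<le> 1" for k
        using T(4)[OF t, of "j k"] D(2)[of "j k"] unfolding A_image N_def by blast
    qed (use t T(1) in auto)
    then show "\<not> (\<exists>x\<in>limit_set. \<exists>y\<in>limit_set. \<exists>z\<in>limit_set. nontrivial_solution t x y z)"
      unfolding nontrivial_solution_def by blast
  qed
qed

end
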